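(* Let $k$ be a field, $n\ge1$, $A=k[x_1,\ldots,x_n]/\langle x_1\cdots x_n\rangle$ and $A^e=A\otimes_kA$. Let $f:F_i\to A$ be a cocycle in $\mathrm{Hom}_{A^e}(F_i,A)$, i.e. $f\circ d_{i+1}=0$. For each $j\in\mathbb{N}=\{0,1,2,\ldots\}$ define an $A^e$-homomorphism $\tilde f_j:F_{i+j}\to F_j$ on a basis element $x=e_{i_1\cdots i_m}t^{(q)}$ of $F_{i+j}$ ($1\le i_1<\cdots<i_m\le n$, $m+2q=i+j$) by $$\tilde f_j(x)=\sum_{\mathcal{M}}(-1)^{ms+j_1+\cdots+j_r-r}\;U_{l_s}\cdots U_{l_1}\cdot e_{i_{j_r}\cdots i_{j_1}}t^{(u)}\cdot\left(\frac{f\big(e_{i_1\cdots\widehat{i}_{j_1}\cdots\widehat{i}_{j_r}\cdots i_m}\wedge e_{l_1\cdots l_s}\,t^{(q-u-s)}\big)}{x_{l_1}\cdots x_{l_s}}\otimes1\right),$$ where the sum is over the set $\mathcal{M}$ of triples $(u,J,L)$ with $u\ge 0$, $J=\{j_1,\ldots,j_r\}$, $L=\{l_1,\ldots,l_s\}$ satisfying $r+s+2u=j$, $1\leq j_1<\cdots<j_r\leq m$ and $1\leq l_1<\cdots<l_s\leq n$. Then $\epsilon\circ\tilde f_0=f$ and $d_j\circ\tilde f_j=\tilde f_{j-1}\circ d_{i+j}$ for all $j\geq1$; that is, $\tilde f$ is a chain map lifting $f$.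
   Context: $F_\bullet$ is the following free resolution of the $A^e$-module $A$ (with augmentation $\epsilon:F_0=A^e\to A$, $a\otimes b\mapsto ab$): $F_m$ is the free $A^e$-module with basis the symbols $e_It^{(q)}$, where $I\subseteq\{1,\ldots,n\}$, $q\geq0$, $|I|+2q=m$, and $e_I=e_{i_1\cdots i_s}=e_{i_1}\wedge\cdots\wedge e_{i_s}$ for $I=\{i_1<\cdots<i_s\}$. The differential is $d(e_It^{(q)})=\sum_{j=1}^s(-1)^{j-1}(1\otimes x_{i_j}-x_{i_j}\otimes1)e_{I\smallsetminus\{i_j\}}t^{(q)}+\sum_{j=1}^n(x_1\cdots x_{j-1}\otimes x_{j+1}\cdots x_n)\,e_j\wedge e_I\,t^{(q-1)}$, the second sum being omitted if $q=0$. More generally $e_{a_1\cdots a_s}$ denotes $e_{a_1}\wedge\cdots\wedge e_{a_s}$ in the exterior algebra for any sequence of indices (e.g. $e_{i_{j_r}\cdots i_{j_1}}=e_{i_{j_r}}\wedge\cdots\wedge e_{i_{j_1}}$), and products of elements $U_l$, $e$'s and $t^{(u)}$ are taken in the exterior algebra over $A^e$ on $e_1,\ldots,e_n$, with $t^{(u)}$ as an additional symbol on the right. A hat denotes omission of an index. For $z\in\{1,\ldots,n\}$, $U_z:=\sum_{j=z+1}^n(x_1\cdots x_{j-1}\otimes x_{j+1}\cdots x_n)\,e_j\in F_1$, with $U_n=0$. Conventions: $f(e_It^{(p)})=0$ if $p<0$. Since $f$ is a cocycle, when $e_{i_1\cdots\widehat{i}_{j_1}\cdots\widehat{i}_{j_r}\cdots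 i_m}\wedge e_{l_1\cdots l_s}\neq0$ every monomial occurring in the value of $f$ in the formula (written in the $k$-basis of $A$ consisting of the monomials not divisible by $x_1\cdots x_n$) is divisible by $x_{l_1}\cdots x_{l_s}$; the quotient is the element of $A$ obtained by dividing each of these monomials by $x_{l_1}\cdots x_{l_s}$. The quotient is $0$ when the value of $f$ is $0$. *)

theory Defs
  imports "HOL-Library.Poly_Mapping" "HOL-Library.Product_Plus"
begin

section \<open>The algebra $A = k[x_1,\dots,x_n]/\langle x_1\cdots x_n\rangle$\<close>

text \<open>
  The index set $\{1,\dots,n\}$ is rendered by an arbitrary type \<open>'n\<close> of class
  \<open>{finite, linorder}\<close>, so that $n = $ \<open>CARD('n)\<close> $\ge 1$ and
  \<open>{..<j}\<close>, \<open>{j<..}\<close> are the indices before and after \<open>j\<close>.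
  Polynomials over \<open>'k\<close> in the variables \<open>x\<^sub>i\<close> are finitely supported functions from
  exponents \<open>'n \<Rightarrow>\<^sub>0 nat\<close> to \<open>'k\<close>.
\<close>

type_synonym ('n, 'k) mpoly = "('n \<Rightarrow>\<^sub>0 nat) \<Rightarrow>\<^sub>0 'k"

definition pvar :: "'n \<Rightarrow> ('n, 'k::field) mpoly" where
  "pvar i = Poly_Mapping.single (Poly_Mapping.single i 1) 1"

definition all_vars :: "('n::finite, 'k::field) mpoly" where
  "all_vars = (\<Prod>i\<in>UNIV. pvar i)"

definition sqfree_exp :: "'n set \<Rightarrow> ('n \<Rightarrow>\<^sub>0 nat)" where
  "sqfree_exp L = (\<Sum>i\<in>L. Poly_Mapping.single i 1)"

lemma lookup_sqfree_exp:
  "finite L \<Longrightarrow> Poly_Mapping.lookup (sqfree_exp L) i = (if i \<in> L then 1 else 0)"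
  by (simp add: sqfree_exp_def lookup_sum lookup_single when_def)

lemma prod_pvar: "finite L \<Longrightarrow> (\<Prod>i\<in>L. pvar i) = Poly_Mapping.single (sqfree_exp L) 1"
  by (induction L rule: finite_induct)
    (simp_all add: sqfree_exp_def pvar_def mult_single)

quotient_type (overloaded) ('n, 'k) nc_alg = "('n::finite, 'k::field) mpoly" / "\<lambda>p q. all_vars dvd p - q"
  morphisms rep_nc_alg poly_class
proof (rule equivpI)
  show "reflp (\<lambda>p q :: ('n, 'k) mpoly. all_vars dvd p - q)"
    by (simp add: reflp_def)
  show "symp (\<lambda>p q :: ('n, 'k) mpoly. all_vars dvd p - q)"
    by (metis (mono_tags, lifting) sympI dvd_minus_iff minus_diff_eq)
  show "transp (\<lambda>p q :: ('n, 'k) mpoly. all_vars dvd p - q)"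
    by (rule transpI) (metis (no_types, lifting) diff_add_cancel add_diff_eq dvd_add)
qed

text \<open>Polynomials all of whose monomials are not divisible by $x_1\cdots x_n$.\<close>

definition reduced :: "('n::finite, 'k::field) mpoly \<Rightarrow> bool" where
  "reduced p \<longleftrightarrow> (\<forall>\<alpha>\<in>Poly_Mapping.keys p. \<exists>i. Poly_Mapping.lookup \<alpha> i = 0)"

lemma single_exp_factor:
  assumes "\<And>i. Poly_Mapping.lookup \<alpha> i \<noteq> 0"
  shows "(all_vars :: ('n::finite, 'k::field) mpoly) dvd Poly_Mapping.single \<alpha> c"
proof -
  have "\<alpha> = sqfree_exp UNIV + (\<alpha> - sqfree_exp UNIV)"
    using assms by (intro poly_mapping_eqI) (simp add: lookup_add lookup_minus lookup_sqfree_exp Suc_leI)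
  then have "Poly_Mapping.single \<alpha> c =
      (all_vars :: ('n, 'k) mpoly) * Poly_Mapping.single (\<alpha> - sqfree_exp UNIV) c"
    by (simp add: all_vars_def prod_pvar mult_single)
  then show ?thesis by (rule dvdI)
qed

lemma lookup_all_vars_mult:
  fixes q :: "('n::finite, 'k::field) mpoly"
  assumes "Poly_Mapping.lookup \<alpha> i = 0"
  shows "Poly_Mapping.lookup (all_vars * q) \<alpha> = 0"
proof (rule ccontr)
  assume "Poly_Mapping.lookup (all_vars * q) \<alpha> \<noteq> 0"
  then have "\<alpha> \<in> Poly_Mapping.keys (Poly_Mapping.single (sqfree_exp UNIV) 1 * q)"
    by (simp add: in_keys_iff all_vars_def prod_pvar)
  then obtain \<beta> where "\<alpha> = sqfree_exp UNIV + \<beta>"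
    using keys_mult by fastforce
  with assms show False by (simp add: lookup_add lookup_sqfree_exp)
qed

lemma reduced_dvd_eq_0:
  assumes "reduced p" "all_vars dvd p"
  shows "p = 0"
proof (rule poly_mapping_eqI)
  fix \<alpha>
  show "Poly_Mapping.lookup p \<alpha> = Poly_Mapping.lookup 0 \<alpha>"
  proof (cases "\<alpha> \<in> Poly_Mapping.keys p")
    case True
    with assms(1) obtain i where "Poly_Mapping.lookup \<alpha> i = 0"
      by (auto simp: reduced_def)
    moreover obtain q where "p = all_vars * q"
      using assms(2) by (rule dvdE)
    ultimately show ?thesis by (simp add: lookup_all_vars_mult)
  qed (simp add: in_keys_iff)
qed

lemma not_all_vars_dvd_one: "\<not> (all_vars :: ('n::finite, 'k::field) mpoly) dvd 1"
proof
  assume "(all_vars :: ('n, 'k) mpoly) dvd 1"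
  moreover have "reduced (1 :: ('n, 'k) mpoly)"
    by (simp add: reduced_def)
  ultimately have "(1 :: ('n, 'k) mpoly) = 0" by (metis reduced_dvd_eq_0)
  then show False by simp
qed

instantiation nc_alg :: (finite, field) comm_ring_1
begin

lift_definition zero_nc_alg :: "('a, 'b) nc_alg" is 0 .
lift_definition one_nc_alg :: "('a, 'b) nc_alg" is 1 .
lift_definition plus_nc_alg :: "('a, 'b) nc_alg \<Rightarrow> ('a, 'b) nc_alg \<Rightarrow> ('a, 'b) nc_alg" is "(+)"
proof -
  fix p p' q q' :: "('a, 'b) mpoly"
  assume "all_vars dvd p - p'" "all_vars dvd q - q'"
  then have "all_vars dvd (p - p') + (q - q')" by (rule dvd_add)
  then show "all_vars dvd (p + q) - (p' + q')" by (simp add: algebra_simps)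
qed
lift_definition uminus_nc_alg :: "('a, 'b) nc_alg \<Rightarrow> ('a, 'b) nc_alg" is uminus
proof -
  fix p p' :: "('a, 'b) mpoly"
  assume "all_vars dvd p - p'"
  then have "all_vars dvd - (p - p')" by (simp only: dvd_minus_iff)
  then show "all_vars dvd - p - - p'" by simp
qed
lift_definition minus_nc_alg :: "('a, 'b) nc_alg \<Rightarrow> ('a, 'b) nc_alg \<Rightarrow> ('a, 'b) nc_alg" is "(-)"
proof -
  fix p p' q q' :: "('a, 'b) mpoly"
  assume "all_vars dvd p - p'" "all_vars dvd q - q'"
  then have "all_vars dvd (p - p') - (q - q')" by (rule dvd_diff)
  then show "all_vars dvd (p - q) - (p' - q')" by (simp add: algebra_simps)
qed
lift_definition times_nc_alg :: "('a, 'b) nc_alg \<Rightarrow> ('a, 'b) nc_alg \<Rightarrow> ('a, 'b) nc_alg" is "(*)"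
proof -
  fix p p' q q' :: "('a, 'b) mpoly"
  assume "all_vars dvd p - p'" "all_vars dvd q - q'"
  moreover have "p * q - p' * q' = (p - p') * q + p' * (q - q')"
    by (simp add: algebra_simps)
  ultimately show "all_vars dvd p * q - p' * q'"
    by (metis dvd_add dvd_mult dvd_mult2)
qed

instance
  by standard (transfer; simp add: algebra_simps not_all_vars_dvd_one)+

end

definition xvar :: "'n::finite \<Rightarrow> ('n, 'k::field) nc_alg" where
  "xvar i = poly_class (pvar i)"

definition const :: "'k::field \<Rightarrow> ('n::finite, 'k) nc_alg" where
  "const c = poly_class (Poly_Mapping.single 0 c)"

text \<open>
  \<open>normal_form a\<close> is the expansion of \<open>a\<close> in the basis of $A$ consisting of the monomials
  not divisible by $x_1\cdots x_n$.
\<close>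

definition normal_form :: "('n::finite, 'k::field) nc_alg \<Rightarrow> ('n, 'k) mpoly" where
  "normal_form a = (THE p. reduced p \<and> poly_class p = a)"

lemma poly_class_eq_iff: "poly_class p = poly_class q \<longleftrightarrow> all_vars dvd p - q"
  by (rule nc_alg.abs_eq_iff)

lemma sum_single: "(\<Sum>\<alpha>\<in>Poly_Mapping.keys p. Poly_Mapping.single \<alpha> (Poly_Mapping.lookup p \<alpha>)) = p"
  by (rule poly_mapping_eqI) (simp add: lookup_sum lookup_single when_def in_keys_iff)

lemma ex1_normal_form: "\<exists>!p. reduced p \<and> poly_class p = a"
proof -
  obtain p where p: "a = poly_class p" by (metis Quotient3_abs_rep[OF Quotient3_nc_alg])
  let ?m = "\<lambda>\<alpha>. Poly_Mapping.single \<alpha> (Poly_Mapping.lookup p \<alpha>)"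
  let ?K = "{\<alpha>\<in>Poly_Mapping.keys p. \<exists>i. Poly_Mapping.lookup \<alpha> i = 0}"
  define r where "r = sum ?m ?K"
  define s where "s = sum ?m (Poly_Mapping.keys p - ?K)"
  have "p = r + s"
    using sum.subset_diff[of ?K "Poly_Mapping.keys p" ?m] sum_single[of p]
    by (simp add: r_def s_def add.commute)
  moreover have "all_vars dvd s"
    unfolding s_def by (rule dvd_sum) (auto intro: single_exp_factor)
  ultimately have "poly_class p = poly_class r"
    by (simp add: poly_class_eq_iff)
  then have "poly_class r = a"
    by (simp add: p)
  moreover have "reduced r"
    unfolding reduced_def
  proof
    fix \<alpha> assume "\<alpha> \<in> Poly_Mapping.keys r"
    then have "\<alpha> \<in> ?K"
      by (auto simp: in_keys_iff r_def lookup_sum lookup_single when_def split: if_splits)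
    then show "\<exists>i. Poly_Mapping.lookup \<alpha> i = 0" by simp
  qed
  moreover have "q = r" if "reduced q" "poly_class q = a" for q
  proof -
    have "reduced (q - r)"
      unfolding reduced_def
    proof
      fix \<alpha> assume "\<alpha> \<in> Poly_Mapping.keys (q - r)"
      then have "\<alpha> \<in> Poly_Mapping.keys q \<or> \<alpha> \<in> Poly_Mapping.keys r"
        by (auto simp: in_keys_iff lookup_minus)
      then show "\<exists>i. Poly_Mapping.lookup \<alpha> i = 0"
        using \<open>reduced r\<close> \<open>reduced q\<close> by (auto simp: reduced_def)
    qed
    moreover have "all_vars dvd q - r"
      using that \<open>poly_class r = a\<close> by (metis poly_class_eq_iff)
    ultimately show ?thesis using reduced_dvd_eq_0 by fastforce
  qed
  ultimately show ?thesis by blast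
qed

lemma normal_form: "reduced (normal_form a)" "poly_class (normal_form a) = a"
  using theI'[OF ex1_normal_form[of a]] by (simp_all add: normal_form_def)

lemma normal_form_eqI: "reduced p \<Longrightarrow> poly_class p = a \<Longrightarrow> normal_form a = p"
  unfolding normal_form_def by (rule the1_equality[OF ex1_normal_form]) simp

text \<open>
  Every basis monomial occurring in \<open>a\<close> is divisible by $\prod_{l\in L} x_l$.
\<close>

definition monomial_dvd :: "'n::finite set \<Rightarrow> ('n, 'k::field) nc_alg \<Rightarrow> bool" where
  "monomial_dvd L a \<longleftrightarrow>
     (\<forall>\<alpha>\<in>Poly_Mapping.keys (normal_form a). \<forall>l\<in>L. Poly_Mapping.lookup \<alpha> l \<ge> 1)"

text \<open>
  Divides each basis monomial of \<open>a\<close> by $\prod_{l\in L} x_l$.  Subtraction of exponents is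
  truncated, so this is meaningful only if \<open>monomial_dvd L a\<close>.
\<close>

definition monomial_quot :: "('n, 'k) nc_alg \<Rightarrow> 'n::finite set \<Rightarrow> ('n, 'k::field) nc_alg" where
  "monomial_quot a L = poly_class (\<Sum>\<alpha>\<in>Poly_Mapping.keys (normal_form a).
     Poly_Mapping.single (\<alpha> - sqfree_exp L) (Poly_Mapping.lookup (normal_form a) \<alpha>))"


section \<open>The enveloping algebra $A^e = A\otimes_k A$\<close>

text \<open>
  \<open>mult_monoid\<close> is the multiplicative monoid of a ring, written additively, so that
  \<open>('a mult_monoid \<times> 'a mult_monoid) \<Rightarrow>\<^sub>0 'k\<close> is the free \<open>'k\<close>-vector space on
  \<open>'a \<times> 'a\<close> with the product determined by $(a,b)(a',b') = (aa',bb')$.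
\<close>

datatype 'a mult_monoid = Mult (unMult: 'a)

instantiation mult_monoid :: (comm_monoid_mult) comm_monoid_add
begin

definition "0 = Mult 1"
definition "a + b = Mult (unMult a * unMult b)"

instance
  by standard (simp_all add: zero_mult_monoid_def plus_mult_monoid_def mult_ac)

end

type_synonym ('n, 'k) free_pairs =
  "(('n, 'k) nc_alg mult_monoid \<times> ('n, 'k) nc_alg mult_monoid) \<Rightarrow>\<^sub>0 'k"

definition pair :: "('n::finite, 'k::field) nc_alg \<Rightarrow> ('n, 'k) nc_alg \<Rightarrow> ('n, 'k) free_pairs" where
  "pair a b = Poly_Mapping.single (Mult a, Mult b) 1"

text \<open>
  The subspace spanned by the relations that make \<open>pair\<close> \<open>'k\<close>-bilinear.
  Multiplication by \<open>Poly_Mapping.single 0 c\<close> is scalar multiplication by \<open>c\<close>.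
\<close>

inductive_set bilinear_relations :: "('n::finite, 'k::field) free_pairs set" where
  zero: "0 \<in> bilinear_relations"
| plus: "u \<in> bilinear_relations \<Longrightarrow> v \<in> bilinear_relations \<Longrightarrow> u + v \<in> bilinear_relations"
| scale: "u \<in> bilinear_relations \<Longrightarrow> Poly_Mapping.single 0 c * u \<in> bilinear_relations"
| add_left: "pair (a + a') b - pair a b - pair a' b \<in> bilinear_relations"
| add_right: "pair a (b + b') - pair a b - pair a b' \<in> bilinear_relations"
| scale_left: "pair (const c * a) b - Poly_Mapping.single 0 c * pair a b \<in> bilinear_relations"
| scale_right: "pair a (const c * b) - Poly_Mapping.single 0 c * pair a b \<in> bilinear_relations"

lemma pair_mult_pair: "pair a b * pair a' b' = pair (a * a') (b * b')"
  by (simp add: pair_def mult_single plus_mult_monoid_def)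

lemma pair_mult_relation:
  assumes "u \<in> bilinear_relations"
  shows "pair a b * u \<in> bilinear_relations"
  using assms
proof (induction rule: bilinear_relations.induct)
  case (plus u v)
  then show ?case by (simp add: distrib_left bilinear_relations.plus)
next
  case (scale u c)
  then show ?case
    using bilinear_relations.scale[of "pair a b * u" c] by (simp only: mult.left_commute)
next
  case (add_left a1 a2 b1)
  show ?case
    using bilinear_relations.add_left[of "a * a1" "a * a2" "b * b1"]
    by (simp add: right_diff_distrib pair_mult_pair distrib_left)
next
  case (add_right a1 b1 b2)
  show ?case
    using bilinear_relations.add_right[of "a * a1" "b * b1" "b * b2"]
    by (simp add: right_diff_distrib pair_mult_pair distrib_left)
next
  case (scale_left c a1 b1)
  show ?case
    using bilinear_relations.scale_left[of c "a * a1" "b * b1"]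
    by (simp add: right_diff_distrib pair_mult_pair mult.left_commute[of a "const c"]
        mult.left_commute[of "pair a b" "Poly_Mapping.single 0 c"])
next
  case (scale_right a1 c b1)
  show ?case
    using bilinear_relations.scale_right[of "a * a1" c "b * b1"]
    by (simp add: right_diff_distrib pair_mult_pair mult.left_commute[of b "const c"]
        mult.left_commute[of "pair a b" "Poly_Mapping.single 0 c"])
qed (simp add: bilinear_relations.zero)

lemma relation_sum:
  "(\<And>i. i \<in> I \<Longrightarrow> g i \<in> bilinear_relations) \<Longrightarrow> sum g I \<in> bilinear_relations"
  by (induction I rule: infinite_finite_induct)
    (auto intro: bilinear_relations.intros)

lemma mult_relation:
  assumes "u \<in> bilinear_relations"
  shows "v * u \<in> bilinear_relations"
proof -
  have single: "Poly_Mapping.single k c = Poly_Mapping.single 0 c * pair (unMult (fst k)) (unMult (snd k))"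
    for k c by (simp add: pair_def mult_single)
  have "v * u = (\<Sum>k\<in>Poly_Mapping.keys v. Poly_Mapping.single k (Poly_Mapping.lookup v k)) * u"
    by (simp add: sum_single)
  also have "\<dots> = (\<Sum>k\<in>Poly_Mapping.keys v. Poly_Mapping.single 0 (Poly_Mapping.lookup v k) *
      (pair (unMult (fst k)) (unMult (snd k)) * u))"
    by (subst single) (simp add: sum_distrib_right mult.assoc)
  also have "\<dots> \<in> bilinear_relations"
    by (intro relation_sum bilinear_relations.scale pair_mult_relation assms)
  finally show ?thesis .
qed

lemma uminus_relation: "u \<in> bilinear_relations \<Longrightarrow> - u \<in> bilinear_relations"
  using mult_relation[of u "-1"] by simp

lemma diff_relation:
  "u \<in> bilinear_relations \<Longrightarrow> v \<in> bilinear_relations \<Longrightarrow> u - v \<in> bilinear_relations"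
  using bilinear_relations.plus[of u "- v"] uminus_relation[of v] by simp

quotient_type (overloaded) ('n, 'k) nc_env = "('n::finite, 'k::field) free_pairs" / "\<lambda>u v. u - v \<in> bilinear_relations"
  morphisms rep_nc_env pairs_class
proof (rule equivpI)
  show "reflp (\<lambda>u v :: ('n, 'k) free_pairs. u - v \<in> bilinear_relations)"
    by (simp add: reflp_def bilinear_relations.zero)
  show "symp (\<lambda>u v :: ('n, 'k) free_pairs. u - v \<in> bilinear_relations)"
    by (metis (mono_tags, lifting) sympI uminus_relation minus_diff_eq)
  show "transp (\<lambda>u v :: ('n, 'k) free_pairs. u - v \<in> bilinear_relations)"
    by (rule transpI) (metis (no_types, lifting) diff_add_cancel add_diff_eq bilinear_relations.plus)
qed

text \<open>The multiplication $A\otimes_k A\to A$, $a\otimes b\mapsto ab$, on the free vector space.\<close>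

definition mult_pairs :: "('n::finite, 'k::field) free_pairs \<Rightarrow> ('n, 'k) nc_alg" where
  "mult_pairs u = (\<Sum>k\<in>Poly_Mapping.keys u.
     const (Poly_Mapping.lookup u k) * (unMult (fst k) * unMult (snd k)))"

lemma const_0: "const 0 = 0"
  by (simp add: const_def zero_nc_alg_def)

lemma const_1: "const 1 = 1"
  by (simp add: const_def one_nc_alg_def)

lemma const_add: "const (c + d) = const c + const d"
  by (simp add: const_def plus_nc_alg.abs_eq single_add)

lemma const_mult: "const (c * d) = const c * const d"
  by (simp add: const_def times_nc_alg.abs_eq mult_single)

lemma mult_pairs_add: "mult_pairs (u + v) = mult_pairs u + mult_pairs v"
  unfolding mult_pairs_def
  by (rule setsum_keys_plus_distrib) (simp_all add: const_0 const_add distrib_right)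

lemma mult_pairs_diff: "mult_pairs (u - v) = mult_pairs u - mult_pairs v"
  by (metis add_diff_cancel diff_add_cancel mult_pairs_add)

lemma mult_pairs_single:
  "mult_pairs (Poly_Mapping.single k c) = const c * (unMult (fst k) * unMult (snd k))"
  by (cases "c = 0") (simp_all add: mult_pairs_def const_0)

lemma mult_pairs_pair: "mult_pairs (pair a b) = a * b"
  by (simp add: pair_def mult_pairs_single const_1)

lemma mult_pairs_sum: "mult_pairs (sum g I) = (\<Sum>i\<in>I. mult_pairs (g i))"
  by (induction I rule: infinite_finite_induct)
    (simp_all add: mult_pairs_add, simp_all add: mult_pairs_def)

lemma mult_pairs_scale: "mult_pairs (Poly_Mapping.single 0 c * u) = const c * mult_pairs u"
proof -
  have "mult_pairs (Poly_Mapping.single 0 c * u) =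
      mult_pairs (\<Sum>k\<in>Poly_Mapping.keys u. Poly_Mapping.single k (c * Poly_Mapping.lookup u k))"
    by (subst sum_single[of u, symmetric]) (simp add: sum_distrib_left mult_single)
  then show ?thesis
    by (simp add: mult_pairs_sum mult_pairs_single const_mult mult.assoc)
      (simp add: mult_pairs_def sum_distrib_left)
qed

lemma mult_pairs_relation:
  assumes "u \<in> bilinear_relations"
  shows "mult_pairs u = 0"
  using assms
proof (induction rule: bilinear_relations.induct)
  case zero
  show ?case by (simp add: mult_pairs_def)
qed (simp_all add: mult_pairs_add mult_pairs_diff mult_pairs_scale mult_pairs_pair
      distrib_left distrib_right mult.assoc mult.left_commute)

lemma one_eq_pair: "1 = pair 1 1"
  by (simp add: pair_def flip: zero_mult_monoid_def single_one zero_prod_def)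

lemma one_not_relation: "1 \<notin> bilinear_relations"
proof
  assume "(1 :: ('n::finite, 'k::field) free_pairs) \<in> bilinear_relations"
  then have "mult_pairs (pair 1 1 :: ('n, 'k) free_pairs) = 0"
    unfolding one_eq_pair by (rule mult_pairs_relation)
  then show False
    by (simp add: mult_pairs_pair)
qed

instantiation nc_env :: (finite, field) comm_ring_1
begin

lift_definition zero_nc_env :: "('a, 'b) nc_env" is 0 .
lift_definition one_nc_env :: "('a, 'b) nc_env" is 1 .
lift_definition plus_nc_env :: "('a, 'b) nc_env \<Rightarrow> ('a, 'b) nc_env \<Rightarrow> ('a, 'b) nc_env" is "(+)"
proof -
  fix u u' v v' :: "('a, 'b) free_pairs"
  assume "u - u' \<in> bilinear_relations" "v - v' \<in> bilinear_relations"
  then have "(u - u') + (v - v') \<in> bilinear_relations" by (rule bilinear_relations.plus)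
  then show "(u + v) - (u' + v') \<in> bilinear_relations" by (simp add: algebra_simps)
qed
lift_definition uminus_nc_env :: "('a, 'b) nc_env \<Rightarrow> ('a, 'b) nc_env" is uminus
proof -
  fix u u' :: "('a, 'b) free_pairs"
  assume "u - u' \<in> bilinear_relations"
  then have "- (u - u') \<in> bilinear_relations" by (rule uminus_relation)
  then show "- u - - u' \<in> bilinear_relations" by simp
qed
lift_definition minus_nc_env :: "('a, 'b) nc_env \<Rightarrow> ('a, 'b) nc_env \<Rightarrow> ('a, 'b) nc_env" is "(-)"
proof -
  fix u u' v v' :: "('a, 'b) free_pairs"
  assume "u - u' \<in> bilinear_relations" "v - v' \<in> bilinear_relations"
  then have "(u - u') - (v - v') \<in> bilinear_relations" by (rule diff_relation)
  then show "(u - v) - (u' - v') \<in> bilinear_relations" by (simp add: algebra_simps)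
qed
lift_definition times_nc_env :: "('a, 'b) nc_env \<Rightarrow> ('a, 'b) nc_env \<Rightarrow> ('a, 'b) nc_env" is "(*)"
proof -
  fix u u' v v' :: "('a, 'b) free_pairs"
  assume "u - u' \<in> bilinear_relations" "v - v' \<in> bilinear_relations"
  then have "v * (u - u') + u' * (v - v') \<in> bilinear_relations"
    by (intro bilinear_relations.plus mult_relation)
  then show "u * v - u' * v' \<in> bilinear_relations" by (simp add: algebra_simps)
qed

instance
proof
  fix x y z :: "('a, 'b) nc_env"
  show "x + y + z = x + (y + z)"
    by transfer (simp add: add.assoc bilinear_relations.zero)
  show "x + y = y + x"
    by transfer (simp add: add.commute bilinear_relations.zero)
  show "0 + x = x" "- x + x = 0" "x - y = x + - y"
    by (transfer; simp add: bilinear_relations.zero)+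
  show "x * y * z = x * (y * z)"
    by transfer (simp add: mult.assoc bilinear_relations.zero)
  show "x * y = y * x"
    by transfer (simp add: mult.commute bilinear_relations.zero)
  show "1 * x = x"
    by transfer (simp add: bilinear_relations.zero)
  show "(x + y) * z = x * z + y * z"
    by transfer (simp add: distrib_right bilinear_relations.zero)
  show "(0 :: ('a, 'b) nc_env) \<noteq> 1"
    by transfer (use uminus_relation[of "-1"] one_not_relation in auto)
qed

end

definition tensor :: "('n::finite, 'k::field) nc_alg \<Rightarrow> ('n, 'k) nc_alg \<Rightarrow> ('n, 'k) nc_env"
    (infixl "\<otimes>" 75) where
  "a \<otimes> b = pairs_class (pair a b)"

lift_definition mult_map :: "('n::finite, 'k::field) nc_env \<Rightarrow> ('n, 'k) nc_alg" is mult_pairs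
  by (metis mult_pairs_diff mult_pairs_relation eq_iff_diff_eq_0)

lemma mult_map_tensor: "mult_map (a \<otimes> b) = a * b"
  by (simp add: tensor_def mult_map.abs_eq mult_pairs_pair)

text \<open>$A$ is an $A^e$-module by $(a\otimes b)\cdot c = acb$.\<close>

definition alg_scale :: "('n::finite, 'k::field) nc_env \<Rightarrow> ('n, 'k) nc_alg \<Rightarrow> ('n, 'k) nc_alg" where
  "alg_scale z c = mult_map z * c"


section \<open>Free modules, the exterior algebra and the resolution $F_\bullet$\<close>

text \<open>\<open>'b \<Rightarrow>\<^sub>0 'r\<close> is the free \<open>'r\<close>-module with basis \<open>'b\<close>.\<close>

definition free_scale :: "'r::comm_ring_1 \<Rightarrow> ('b \<Rightarrow>\<^sub>0 'r) \<Rightarrow> ('b \<Rightarrow>\<^sub>0 'r)" where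
  "free_scale c v = Poly_Mapping.map ((*) c) v"

definition linear_extension :: "('b \<Rightarrow> 'c \<Rightarrow>\<^sub>0 'r) \<Rightarrow> ('b \<Rightarrow>\<^sub>0 'r::comm_ring_1) \<Rightarrow> ('c \<Rightarrow>\<^sub>0 'r)" where
  "linear_extension g v = (\<Sum>b\<in>Poly_Mapping.keys v. free_scale (Poly_Mapping.lookup v b) (g b))"

definition module_hom_between ::
  "('r \<Rightarrow> 'x \<Rightarrow> 'x) \<Rightarrow> ('r \<Rightarrow> 'y \<Rightarrow> 'y) \<Rightarrow> 'x::plus set \<Rightarrow> 'y::plus set \<Rightarrow> ('x \<Rightarrow> 'y) \<Rightarrow> bool" where
  "module_hom_between s s' M N h \<longleftrightarrow>
     (\<forall>v\<in>M. h v \<in> N) \<and>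
     (\<forall>v\<in>M. \<forall>w\<in>M. h (v + w) = h v + h w) \<and>
     (\<forall>c. \<forall>v\<in>M. h (s c v) = s' c (h v))"

text \<open>
  The exterior algebra over $A^e$ on the \<open>e\<^sub>i\<close> is free on the \<open>e\<^sub>I\<close>, and
  $e_I\wedge e_J = \pm e_{I\cup J}$ or $0$, the sign being given by the number of inversions.
\<close>

type_synonym ('n, 'k) ext = "'n set \<Rightarrow>\<^sub>0 ('n, 'k) nc_env"

definition ext_basis :: "'n::finite set \<Rightarrow> ('n, 'k::field) ext" where
  "ext_basis I = Poly_Mapping.single I 1"

definition inversions :: "'n::linorder set \<Rightarrow> 'n set \<Rightarrow> nat" where
  "inversions I J = card {(a, b). a \<in> I \<and> b \<in> J \<and> b < a}"

definition wedge :: "('n::{finite, linorder}, 'k::field) ext \<Rightarrow> ('n, 'k) ext \<Rightarrow> ('n, 'k) ext"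
    (infixr "\<and>\<^sub>e" 70) where
  "v \<and>\<^sub>e w = (\<Sum>I\<in>Poly_Mapping.keys v. \<Sum>J\<in>Poly_Mapping.keys w.
     if I \<inter> J = {}
     then Poly_Mapping.single (I \<union> J)
            ((-1) ^ inversions I J * Poly_Mapping.lookup v I * Poly_Mapping.lookup w J)
     else 0)"

definition wedge_list :: "('n::{finite, linorder}, 'k::field) ext list \<Rightarrow> ('n, 'k) ext" where
  "wedge_list vs = foldr (\<and>\<^sub>e) vs (ext_basis {})"

text \<open>$e_{a_1\cdots a_s}$ for a sequence of indices.\<close>

definition ext_seq :: "'n::{finite, linorder} list \<Rightarrow> ('n, 'k::field) ext" where
  "ext_seq as = wedge_list (map (\<lambda>a. ext_basis {a}) as)"

text \<open>
  The direct sum of all \<open>F\<^sub>m\<close> is free on the symbols $e_It^{(q)}$, rendered as \<open>(I, q)\<close>;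
  \<open>F\<^sub>m\<close> is its homogeneous part \<open>F m\<close>.
\<close>

type_synonym ('n, 'k) res = "('n set \<times> nat) \<Rightarrow>\<^sub>0 ('n, 'k) nc_env"

definition F :: "nat \<Rightarrow> ('n::finite, 'k::field) res set" where
  "F m = {v. \<forall>(I, q)\<in>Poly_Mapping.keys v. card I + 2 * q = m}"

text \<open>\<open>w \<cdot>t u\<close> is $w\,t^{(u)}$.\<close>

definition times_t :: "('n::finite, 'k::field) ext \<Rightarrow> nat \<Rightarrow> ('n, 'k) res" (infixl "\<cdot>t" 65) where
  "w \<cdot>t u = (\<Sum>I\<in>Poly_Mapping.keys w. Poly_Mapping.single (I, u) (Poly_Mapping.lookup w I))"

text \<open>$x_1\cdots x_{j-1}\otimes x_{j+1}\cdots x_n$\<close>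

definition split_at :: "'n::{finite, linorder} \<Rightarrow> ('n, 'k::field) nc_env" where
  "split_at j = (\<Prod>i\<in>{..<j}. xvar i) \<otimes> (\<Prod>i\<in>{j<..}. xvar i)"

text \<open>\<open>nth_elem I j\<close> is $i_j$ for $I = \{i_1 < \dots < i_m\}$ and $1\le j\le m$.\<close>

definition nth_elem :: "'n::linorder set \<Rightarrow> nat \<Rightarrow> 'n" where
  "nth_elem I j = sorted_list_of_set I ! (j - 1)"

definition diff_basis :: "'n::{finite, linorder} set \<times> nat \<Rightarrow> ('n, 'k::field) res" where
  "diff_basis = (\<lambda>(I, q).
     (\<Sum>j = 1..card I.
        free_scale ((-1) ^ (j - 1) * (1 \<otimes> xvar (nth_elem I j) - xvar (nth_elem I j) \<otimes> 1))
          (ext_basis (I - {nth_elem I j}) \<cdot>t q))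
     + (if q = 0 then 0
        else \<Sum>j\<in>UNIV. free_scale (split_at j) ((ext_basis {j} \<and>\<^sub>e ext_basis I) \<cdot>t (q - 1))))"

definition dF :: "('n::{finite, linorder}, 'k::field) res \<Rightarrow> ('n, 'k) res" where
  "dF = linear_extension diff_basis"

text \<open>The augmentation; \<open>F 0\<close> is free on the single symbol $e_\emptyset t^{(0)}$.\<close>

definition augmentation :: "('n::finite, 'k::field) res \<Rightarrow> ('n, 'k) nc_alg" ("\<epsilon>") where
  "\<epsilon> v = mult_map (Poly_Mapping.lookup v ({}, 0))"


section \<open>The maps $\tilde f_j$\<close>

definition U :: "'n::{finite, linorder} \<Rightarrow> ('n, 'k::field) ext" where
  "U z = (\<Sum>j\<in>{z<..}. free_scale (split_at j) (ext_basis {j}))"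

text \<open>$f(w\,t^{(q-b)})$, read as $0$ if $q-b<0$\<close>

definition eval_t ::
  "(('n::finite, 'k::field) res \<Rightarrow> ('n, 'k) nc_alg) \<Rightarrow> ('n, 'k) ext \<Rightarrow> nat \<Rightarrow> nat \<Rightarrow> ('n, 'k) nc_alg" where
  "eval_t f w q b = (if b \<le> q then f (w \<cdot>t (q - b)) else 0)"

text \<open>
  The index set $\mathcal M$ for a basis element with $|I| = m$, and the summand of
  $\tilde f_j(e_It^{(q)})$ at \<open>(u, J, L)\<close>; here \<open>J\<close> is a set of positions and \<open>L\<close> a set of
  indices.  As all positions are at least 1, the subtraction in the sign exponent is not truncated.
\<close>

definition lift_index :: "nat \<Rightarrow> nat \<Rightarrow> (nat \<times> nat set \<times> 'n set) set" where
  "lift_index m j = {(u, J, L). J \<subseteq> {1..m} \<and> card J + card L + 2 * u = j}"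

definition lift_summand ::
  "(('n::{finite, linorder}, 'k::field) res \<Rightarrow> ('n, 'k) nc_alg) \<Rightarrow> 'n set \<Rightarrow> nat \<Rightarrow>
     nat \<Rightarrow> nat set \<Rightarrow> 'n set \<Rightarrow> ('n, 'k) res" where
  "lift_summand f I q u J L =
     free_scale
       ((-1) ^ (card I * card L + \<Sum>J - card J) *
        (monomial_quot
           (eval_t f (ext_basis (I - nth_elem I ` J) \<and>\<^sub>e ext_basis L) q (u + card L)) L \<otimes> 1))
       ((wedge_list (map U (rev (sorted_list_of_set L)))
         \<and>\<^sub>e ext_seq (map (nth_elem I) (rev (sorted_list_of_set J)))) \<cdot>t u)"

definition lift_basis ::
  "(('n::{finite, linorder}, 'k::field) res \<Rightarrow> ('n, 'k) nc_alg) \<Rightarrow> nat \<Rightarrow> 'n set \<times> nat \<Rightarrow> ('n, 'k) res" where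
  "lift_basis f j = (\<lambda>(I, q). \<Sum>(u, J, L)\<in>lift_index (card I) j. lift_summand f I q u J L)"

definition f_tilde ::
  "(('n::{finite, linorder}, 'k::field) res \<Rightarrow> ('n, 'k) nc_alg) \<Rightarrow> nat \<Rightarrow> ('n, 'k) res \<Rightarrow> ('n, 'k) res" where
  "f_tilde f j = linear_extension (lift_basis f j)"


section \<open>The quotients by monomials are exact\<close>

text \<open>
  For a cocycle \<open>f\<close>, the value $f(e_Kt^{(p)})$ is divisible by $\prod_{l\in K} x_l$.  Up to sign
  the dividends in \<open>lift_summand\<close> are $0$ or such values with $L\subseteq K$, so the truncated
  subtraction in \<open>monomial_quot\<close> never comes into play.
\<close>

lemma free_scale_single [simp]: "free_scale c (Poly_Mapping.single b r) = Poly_Mapping.single b (c * r)"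
  by (simp add: free_scale_def)

lemma lookup_free_scale: "Poly_Mapping.lookup (free_scale c v) b = c * Poly_Mapping.lookup v b"
  by (simp add: free_scale_def map.rep_eq when_def)

lemma free_scale_1 [simp]: "free_scale 1 v = v"
  by (rule poly_mapping_eqI) (simp add: lookup_free_scale)

lemma ext_basis_times_t: "ext_basis I \<cdot>t q = Poly_Mapping.single (I, q) 1"
  by (simp add: ext_basis_def times_t_def)

lemma wedge_basis:
  "(ext_basis I \<and>\<^sub>e ext_basis J) \<cdot>t q =
     (if I \<inter> J = {} then Poly_Mapping.single (I \<union> J, q) ((-1) ^ inversions I J) else 0)"
proof -
  have "(-1) ^ k \<noteq> (0 :: ('a, 'b) nc_env)" for k
    by (cases "even k") simp_all
  then show ?thesis by (simp add: wedge_def ext_basis_def times_t_def)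
qed

lemma single_in_F: "card I + 2 * q = m \<Longrightarrow> Poly_Mapping.single (I, q) c \<in> F m"
  by (cases "c = 0") (simp_all add: F_def)

lemma zero_in_F: "0 \<in> F m"
  by (simp add: F_def)

lemma add_in_F: "v \<in> F m \<Longrightarrow> w \<in> F m \<Longrightarrow> v + w \<in> F m"
  using keys_add[of v w] by (fastforce simp: F_def)

lemma sum_in_F: "(\<And>b. b \<in> B \<Longrightarrow> g b \<in> F m) \<Longrightarrow> sum g B \<in> F m"
  by (induction B rule: infinite_finite_induct) (auto simp: zero_in_F add_in_F)

lemma mult_pairs_mult: "mult_pairs (u * v) = mult_pairs u * mult_pairs v"
proof -
  let ?m = "\<lambda>u k. Poly_Mapping.single k (Poly_Mapping.lookup u k)"
  have single: "mult_pairs (Poly_Mapping.single k c * Poly_Mapping.single l c') =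
      mult_pairs (Poly_Mapping.single k c) * mult_pairs (Poly_Mapping.single l c')"
    for k l :: "('n::finite, 'k::field) nc_alg mult_monoid \<times> ('n, 'k) nc_alg mult_monoid" and c c'
    by (simp add: mult_single mult_pairs_single const_mult plus_mult_monoid_def mult_ac)
  have "mult_pairs (sum (?m u) S * sum (?m v) T) = mult_pairs (sum (?m u) S) * mult_pairs (sum (?m v) T)"
    for S T
    by (simp add: sum_product mult_pairs_sum single)
  from this[of "Poly_Mapping.keys u" "Poly_Mapping.keys v"] show ?thesis
    by (simp only: sum_single)
qed

lemma mult_map_mult: "mult_map (y * z) = mult_map y * mult_map z"
  by transfer (rule mult_pairs_mult)

lemma mult_map_1: "mult_map 1 = 1"
  by (simp add: one_nc_env_def mult_map.abs_eq one_eq_pair mult_pairs_pair)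

lemma mult_map_diff: "mult_map (y - z) = mult_map y - mult_map z"
  by transfer (rule mult_pairs_diff)

lemma mult_map_split_at: "mult_map (split_at j) = (\<Prod>i\<in>-{j}. xvar i)"
proof -
  have *: "- {j} = {..<j} \<union> {j<..}" by auto
  show ?thesis
    unfolding split_at_def mult_map_tensor *
    by (rule prod.union_disjoint[symmetric]) auto
qed

lemma poly_class_mult: "poly_class (p * q) = poly_class p * poly_class q"
  by (simp add: times_nc_alg.abs_eq)

lemma prod_xvar: "finite S \<Longrightarrow> (\<Prod>i\<in>S. xvar i) = poly_class (\<Prod>i\<in>S. pvar i)"
  by (induction S rule: finite_induct) (simp_all add: poly_class_mult xvar_def one_nc_alg_def)

lemma lookup_pvar_mult:
  fixes q :: "('n, 'k::field) mpoly"
  assumes "Poly_Mapping.lookup \<alpha> j = 0"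
  shows "Poly_Mapping.lookup (pvar j * q) \<alpha> = 0"
proof (rule ccontr)
  assume "Poly_Mapping.lookup (pvar j * q) \<alpha> \<noteq> 0"
  then have "\<alpha> \<in> Poly_Mapping.keys (pvar j * q)" by (simp add: in_keys_iff)
  then obtain \<beta> where "\<alpha> = Poly_Mapping.single j 1 + \<beta>"
    unfolding pvar_def using keys_mult by fastforce
  with assms show False by (simp add: lookup_add)
qed

lemma lookup_single_mult:
  "Poly_Mapping.lookup (Poly_Mapping.single \<beta> 1 * q) (\<beta> + \<alpha>) = Poly_Mapping.lookup q \<alpha>"
  for q :: "('n, 'k::field) mpoly"
proof -
  have "Poly_Mapping.single \<beta> 1 * q =
      (\<Sum>\<gamma>\<in>Poly_Mapping.keys q. Poly_Mapping.single (\<beta> + \<gamma>) (Poly_Mapping.lookup q \<gamma>))"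
    by (subst (1) sum_single[of q, symmetric]) (simp add: sum_distrib_left mult_single)
  then show ?thesis
    by (simp add: lookup_sum lookup_single when_def in_keys_iff)
qed

lemma monomial_dvd_if_mult_dvd:
  assumes "(\<Prod>i\<in>-{j}. xvar i) * a = xvar j * b"
  shows "monomial_dvd {j} a"
  unfolding monomial_dvd_def
proof (intro ballI)
  fix \<alpha> l assume \<alpha>: "\<alpha> \<in> Poly_Mapping.keys (normal_form a)" and "l \<in> {j}"
  have "poly_class ((\<Prod>i\<in>-{j}. pvar i) * normal_form a) = poly_class (pvar j * normal_form b)"
    using assms by (simp add: poly_class_mult normal_form flip: prod_xvar xvar_def)
  then obtain q where q:
    "(\<Prod>i\<in>-{j}. pvar i) * normal_form a - pvar j * normal_form b = all_vars * q"
    by (auto simp: poly_class_eq_iff elim: dvdE)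
  have all: "all_vars = pvar j * (\<Prod>i\<in>-{j}. pvar i)"
    unfolding all_vars_def by (simp add: prod.remove[of UNIV j] Compl_eq_Diff_UNIV)
  have "(\<Prod>i\<in>-{j}. pvar i) * normal_form a = pvar j * normal_form b + all_vars * q"
    using q by (simp add: diff_eq_eq)
  also have "\<dots> = pvar j * (normal_form b + (\<Prod>i\<in>-{j}. pvar i) * q)"
    by (simp add: all distrib_left mult.assoc)
  finally have eq: "Poly_Mapping.single (sqfree_exp (-{j})) 1 * normal_form a = \<dots>"
    by (simp add: prod_pvar)
  have "Poly_Mapping.lookup \<alpha> j \<noteq> 0"
  proof
    assume "Poly_Mapping.lookup \<alpha> j = 0"
    then have "Poly_Mapping.lookup (sqfree_exp (-{j}) + \<alpha>) j = 0"
      by (simp add: lookup_add lookup_sqfree_exp)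
    then have "Poly_Mapping.lookup (normal_form a) \<alpha> = 0"
      by (metis eq lookup_pvar_mult lookup_single_mult)
    with \<alpha> show False by (simp add: in_keys_iff)
  qed
  with \<open>l \<in> {j}\<close> show "Poly_Mapping.lookup \<alpha> l \<ge> 1" by simp
qed

lemma cocycle_monomial_dvd:
  fixes f :: "('n::{finite, linorder}, 'k::field) res \<Rightarrow> ('n, 'k) nc_alg"
  assumes hom: "module_hom_between free_scale alg_scale (F i) UNIV f"
    and cocycle: "\<forall>v\<in>F (i + 1). f (dF v) = 0"
    and K: "card K + 2 * p = i"
  shows "monomial_dvd K (f (Poly_Mapping.single (K, p) 1))"
proof -
  have f_add: "f (v + w) = f v + f w" if "v \<in> F i" "w \<in> F i" for v w
    using hom that by (simp add: module_hom_between_def)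
  have f_scale: "f (free_scale c v) = mult_map c * f v" if "v \<in> F i" for c v
    using hom that by (simp add: module_hom_between_def alg_scale_def)
  have f_0: "f 0 = 0"
    using f_add[OF zero_in_F zero_in_F] by simp
  have f_sum: "f (sum g B) = (\<Sum>b\<in>B. f (g b))" if "\<And>b. b \<in> B \<Longrightarrow> g b \<in> F i"
    for g :: "'b \<Rightarrow> ('n, 'k) res" and B
    using that by (induction B rule: infinite_finite_induct) (simp_all add: f_0 f_add sum_in_F)
  have "monomial_dvd {j} (f (Poly_Mapping.single (K, p) 1))" if j: "j \<in> K" for j
  proof -
    define I where "I = K - {j}"
    have card: "card I + 2 * p + 1 = i" "j \<notin> I" "insert j I = K"
      using j K card_Suc_Diff1[of K j] by (auto simp: I_def)
    define g :: "'n \<Rightarrow> ('n, 'k) res"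
      where "g l = free_scale (split_at l) ((ext_basis {l} \<and>\<^sub>e ext_basis I) \<cdot>t p)" for l
    define h where "h l = free_scale
        ((-1) ^ (l - 1) * (1 \<otimes> xvar (nth_elem I l) - xvar (nth_elem I l) \<otimes> 1))
        (ext_basis (I - {nth_elem I l}) \<cdot>t (p + 1) :: ('n, 'k) res)" for l
    have g_F: "((ext_basis {l} \<and>\<^sub>e ext_basis I) \<cdot>t p :: ('n, 'k) res) \<in> F i" for l :: 'n
      using card by (simp add: wedge_basis zero_in_F single_in_F)
    have nth_I: "nth_elem I l \<in> I" if "l \<in> {1..card I}" for l
    proof -
      have "l - 1 < card I" using that by auto
      then show ?thesis
        using nth_mem[of "l - 1" "sorted_list_of_set I"] by (simp add: nth_elem_def)
    qed
    have h_F: "(ext_basis (I - {nth_elem I l}) \<cdot>t (p + 1) :: ('n, 'k) res) \<in> F i"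
      if "l \<in> {1..card I}" for l
      using card nth_I[OF that] card_Suc_Diff1[of I "nth_elem I l"]
      by (auto simp: ext_basis_times_t intro!: single_in_F)
    have scale_F: "free_scale c v \<in> F i" if "v \<in> F i" for c and v :: "('n, 'k) res"
      using that by (auto simp: F_def in_keys_iff lookup_free_scale)
    have "f (dF (Poly_Mapping.single (I, p + 1) 1)) = 0"
      using cocycle card by (simp add: single_in_F)
    moreover have "dF (Poly_Mapping.single (I, p + 1) 1) = sum h {1..card I} + sum g UNIV"
      by (simp add: dF_def linear_extension_def diff_basis_def g_def h_def)
    moreover have "f (sum h {1..card I}) = 0"
    proof -
      have "f (sum h {1..card I}) = (\<Sum>l = 1..card I. f (h l))"
        by (rule f_sum) (simp only: h_def scale_F h_F)
      moreover have "f (h l) = 0" if "l \<in> {1..card I}" for l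
        by (simp only: h_def f_scale[OF h_F[OF that]])
          (simp add: mult_map_mult mult_map_diff mult_map_tensor)
      ultimately show ?thesis by simp
    qed
    moreover have "f (sum g UNIV) = (\<Sum>l\<in>UNIV. f (g l))"
      by (rule f_sum) (simp only: g_def scale_F g_F)
    moreover have "f (sum h {1..card I} + sum g UNIV) = f (sum h {1..card I}) + f (sum g UNIV)"
      by (rule f_add; rule sum_in_F) (simp_all only: h_def g_def scale_F h_F g_F)
    ultimately have "(\<Sum>l\<in>UNIV. f (g l)) = 0" by simp
    then have g_j: "f (g j) = - (\<Sum>l\<in>-{j}. f (g l))"
      by (simp add: sum.remove[of UNIV j] Compl_eq_Diff_UNIV eq_neg_iff_add_eq_0)
    have "\<exists>b. f (g l) = xvar j * b" if "l \<in> -{j}" for l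
    proof -
      have "(\<Prod>i\<in>-{l}. xvar i) = xvar j * (\<Prod>i\<in>-{l}-{j}. xvar i :: ('n, 'k) nc_alg)"
        using that by (intro prod.remove) auto
      then have "f (g l) = xvar j * ((\<Prod>i\<in>-{l}-{j}. xvar i) * f ((ext_basis {l} \<and>\<^sub>e ext_basis I) \<cdot>t p))"
        by (simp only: g_def f_scale[OF g_F] mult_map_split_at mult.assoc)
      then show ?thesis by blast
    qed
    then obtain b where b: "f (g l) = xvar j * b l" if "l \<in> -{j}" for l by metis
    have "f (g j) = xvar j * (- (\<Sum>l\<in>-{j}. b l))"
      by (simp add: g_j b sum_distrib_left)
    moreover have "f (g j) = (\<Prod>i\<in>-{j}. xvar i) *
        (mult_map ((-1) ^ inversions {j} I) * f (Poly_Mapping.single (K, p) 1))"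
      (is "_ = _ * (?\<sigma> * ?c)")
    proof -
      have "(ext_basis {j} \<and>\<^sub>e ext_basis I) \<cdot>t p =
          free_scale ((-1) ^ inversions {j} I) (Poly_Mapping.single (K, p) (1 :: ('n, 'k) nc_env))"
        using card by (simp add: wedge_basis)
      then show ?thesis
        using K f_scale[OF g_F[of j], of "split_at j"]
        by (simp add: g_def f_scale single_in_F mult_map_split_at del: free_scale_single)
    qed
    ultimately have eq: "(\<Prod>i\<in>-{j}. xvar i) * (?\<sigma> * ?c) = xvar j * (- (\<Sum>l\<in>-{j}. b l))"
      by simp
    have "?\<sigma> * ?\<sigma> = 1"
      by (simp add: mult_map_1 flip: mult_map_mult power_mult_distrib)
    then have "(\<Prod>i\<in>-{j}. xvar i) * ?c = (?\<sigma> * ?\<sigma>) * ((\<Prod>i\<in>-{j}. xvar i) * ?c)"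
      by simp
    also have "\<dots> = ?\<sigma> * ((\<Prod>i\<in>-{j}. xvar i) * (?\<sigma> * ?c))"
      by (simp only: mult_ac)
    also have "\<dots> = xvar j * (?\<sigma> * (- (\<Sum>l\<in>-{j}. b l)))"
      unfolding eq by (rule mult.left_commute)
    finally have "(\<Prod>i\<in>-{j}. xvar i) * ?c = \<dots>" .
    then show ?thesis by (rule monomial_dvd_if_mult_dvd)
  qed
  then show ?thesis by (simp add: monomial_dvd_def)
qed

end

theory Submission
  imports Defs Complex_Main
begin

text \<open>
  Write $d = \delta + (W\wedge)\,\partial_t$, where $\delta$ is contraction with the elements
  $1\otimes x_i - x_i\otimes1$, $W=\sum_j(x_1\cdots x_{j-1}\otimes x_{j+1}\cdots x_n)e_j$ and
  $\partial_t t^{(u)} = t^{(u-1)}$.  The sign $(-1)^{j_1+\cdots+j_r-r}$ makes the sum over $J$ the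
  coproduct of the exterior algebra, so that
  $\tilde f(w\,t^{(q)}) = \sum_{u,L} U_L\wedge\Phi_L(w)\,t^{(u)}$ with
  $U_L = U_{l_s}\cdots U_{l_1}$ and
  $\Phi_L(w) = \pm\sum w_{(1)}\, f(w_{(2)}\wedge e_L\,t^{(q-u-s)})/x_L$.
  Contraction and $W$ commute with $\Phi_L$ and $U_L$ up to the sign $(-1)^s$, with two exceptions:
  the sum $\delta(U_l)$ telescopes to $(x_1\cdots x_{l-1}\otimes x_{l+1}\cdots x_n)(x_l\otimes1)$
  because $x_1\cdots x_n = 0$, and $\Phi_L(e_j\wedge w)$ has the extra term
  $\pm x_j\Phi_{L\cup\{j\}}(w)$ for $j\notin L$, because dividing by $x_{L\cup\{j\}}$ and multiplying
  by $x_j$ is dividing by $x_L$.  The two kinds of extra terms cancel.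
\<close>

section \<open>Linear maps between free modules\<close>

text \<open>The cocycle condition enters only as divisibility of f(e_K t^(p)) by x_K, to which it is
  equivalent: the contraction part of d dies under f because 1 \<otimes> x_i - x_i \<otimes> 1 acts
  on A as 0, and in the other part a divisible value completes the product x_1...x_n = 0.
  Multiplication by x_j is not injective on A, so a quotient cannot be characterised by an equation
  in A. It is taken monomial by monomial, on the values of f at basis elements, and \<Phi>_L is
  therefore built from the table of values K \<mapsto> f(e_K t^(p)) rather than from f itself. The
  cancelling terms belong to different pairs (u, L), and d joins degree j to degree j - 1. For this
  reason all j are treated by one map on the direct sum of the F_m, with the table set to 0 outside
  degree i. Commutation with d is then an identity free of degree conditions, and the single maps
  are recovered by restriction.\<close>

lemma module_free_scale: "module free_scale"
  by standard (rule poly_mapping_eqI, simp add: lookup_free_scale lookup_add algebra_simps)+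

interpretation free: module free_scale
  by (rule module_free_scale)

abbreviation lin :: "(('b \<Rightarrow>\<^sub>0 'r::comm_ring_1) \<Rightarrow> ('c \<Rightarrow>\<^sub>0 'r)) \<Rightarrow> bool" where
  "lin \<equiv> module_hom free_scale free_scale"

lemma linI:
  "(\<And>v w. h (v + w) = h v + h w) \<Longrightarrow> (\<And>c v. h (free_scale c v) = free_scale c (h v)) \<Longrightarrow> lin h"
  by (intro module_hom.intro module_free_scale module_hom_axioms.intro)

lemma lin_compose: "lin g \<Longrightarrow> lin h \<Longrightarrow> lin (\<lambda>v. g (h v))"
  by (rule linI) (simp_all add: module_hom.add module_hom.scale)

lemma lin_ident: "lin (\<lambda>v. v)"
  by (rule linI) simp_all

lemma lin_add: "lin g \<Longrightarrow> lin h \<Longrightarrow> lin (\<lambda>v. g v + h v)"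
  by (rule linI) (simp_all add: module_hom.add module_hom.scale free.scale_right_distrib)

lemma lin_diff: "lin g \<Longrightarrow> lin h \<Longrightarrow> lin (\<lambda>v. g v - h v)"
  by (rule linI) (simp_all add: module_hom.add module_hom.scale free.scale_right_diff_distrib)

lemma lin_zero: "lin (\<lambda>v. 0)"
  by (rule linI) simp_all

lemma lin_scale: "lin h \<Longrightarrow> lin (\<lambda>v. free_scale c (h v))"
  by (rule linI)
    (simp_all add: module_hom.add module_hom.scale free.scale_right_distrib mult.commute)

lemma lin_sum: "(\<And>i. i \<in> I \<Longrightarrow> lin (h i)) \<Longrightarrow> lin (\<lambda>v. \<Sum>i\<in>I. h i v)"
  by (induction I rule: infinite_finite_induct) (simp_all add: lin_zero lin_add)

lemma lin_if: "(P \<Longrightarrow> lin g) \<Longrightarrow> (\<not> P \<Longrightarrow> lin h) \<Longrightarrow> lin (\<lambda>v. if P then g v else h v)"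
  by (cases P) simp_all

lemma eq_sum_basis:
  "v = (\<Sum>b\<in>Poly_Mapping.keys v. free_scale (Poly_Mapping.lookup v b) (Poly_Mapping.single b 1))"
  for v :: "'b \<Rightarrow>\<^sub>0 'r::comm_ring_1"
  by (rule poly_mapping_eqI) (simp add: lookup_sum lookup_single when_def in_keys_iff)

lemma lin_eqI:
  assumes "lin g" "lin h" "\<And>b. g (Poly_Mapping.single b 1) = h (Poly_Mapping.single b 1)"
  shows "g v = h v"
  by (subst (1 2) eq_sum_basis)
    (simp only: module_hom.sum[OF assms(1)] module_hom.sum[OF assms(2)]
      module_hom.scale[OF assms(1)] module_hom.scale[OF assms(2)] assms(3))

text \<open>Cancellation can shrink the keys of a sum or a multiple; over a common finite superset,
  additivity and homogeneity hold term by term.\<close>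

lemma linear_extension_superset:
  assumes "finite B" "Poly_Mapping.keys v \<subseteq> B"
  shows "linear_extension g v = (\<Sum>b\<in>B. free_scale (Poly_Mapping.lookup v b) (g b))"
  unfolding linear_extension_def
  by (rule sum.mono_neutral_left) (use assms in \<open>auto simp: in_keys_iff\<close>)

lemma lin_linear_extension:
  fixes g :: "'b \<Rightarrow> ('c \<Rightarrow>\<^sub>0 'r::comm_ring_1)"
  shows "lin (linear_extension g)"
proof (rule linI)
  fix v w :: "'b \<Rightarrow>\<^sub>0 'r"
  have "Poly_Mapping.keys (v + w) \<subseteq> Poly_Mapping.keys v \<union> Poly_Mapping.keys w"
    by (rule keys_add)
  then show "linear_extension g (v + w) = linear_extension g v + linear_extension g w"
    by (simp add: linear_extension_superset[of "Poly_Mapping.keys v \<union> Poly_Mapping.keys w"]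
        lookup_add free.scale_left_distrib sum.distrib)
next
  fix c and v :: "'b \<Rightarrow>\<^sub>0 'r"
  have "Poly_Mapping.keys (free_scale c v) \<subseteq> Poly_Mapping.keys v"
    by (auto simp: in_keys_iff lookup_free_scale)
  then show "linear_extension g (free_scale c v) = free_scale c (linear_extension g v)"
    by (simp add: linear_extension_superset[of "Poly_Mapping.keys v"]
        lookup_free_scale free.scale_sum_right)
qed

lemma linear_extension_single: "linear_extension g (Poly_Mapping.single b c) = free_scale c (g b)"
  by (cases "c = 0") (simp_all add: linear_extension_def)

lemma lin_dF: "lin dF"
  unfolding dF_def by (rule lin_linear_extension)

lemma lin_f_tilde: "lin (f_tilde f j)"
  unfolding f_tilde_def by (rule lin_linear_extension)

lemma times_t_eq: "w \<cdot>t u = linear_extension (\<lambda>I. Poly_Mapping.single (I, u) 1) w"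
  by (simp add: times_t_def linear_extension_def)

lemma lin_times_t: "lin (\<lambda>w. w \<cdot>t u)"
  unfolding times_t_eq by (rule lin_linear_extension)

lemma times_t_single: "Poly_Mapping.single I c \<cdot>t u = Poly_Mapping.single (I, u) c"
  by (simp add: times_t_eq linear_extension_single)

text \<open>In this nested form linearity in \<open>v\<close> is immediate; linearity in
  \<open>w\<close> follows once the outer extension is a sum over the fixed keys of
  \<open>v\<close>.\<close>

lemma wedge_eq:
  "v \<and>\<^sub>e w = linear_extension (\<lambda>I. linear_extension (\<lambda>J. if I \<inter> J = {}
     then Poly_Mapping.single (I \<union> J) ((-1) ^ inversions I J) else 0) w) v"
  unfolding wedge_def linear_extension_def
  by (auto simp: free.scale_sum_right mult_ac intro!: sum.cong)

lemma lin_wedge_left: "lin (\<lambda>v. v \<and>\<^sub>e w)"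
  unfolding wedge_eq by (rule lin_linear_extension)

lemma lin_wedge_right: "lin (\<lambda>w. v \<and>\<^sub>e w)"
proof -
  have "lin (\<lambda>w. \<Sum>I\<in>Poly_Mapping.keys v. free_scale (Poly_Mapping.lookup v I) (linear_extension (g I) w))"
    for g :: "'a set \<Rightarrow> 'a set \<Rightarrow> ('a, 'b) ext"
    by (intro lin_sum lin_scale lin_linear_extension)
  then show ?thesis
    by (simp add: wedge_eq linear_extension_def[of _ v])
qed

lemma wedge_single:
  "Poly_Mapping.single I a \<and>\<^sub>e Poly_Mapping.single J b =
     (if I \<inter> J = {} then Poly_Mapping.single (I \<union> J) ((-1) ^ inversions I J * (a * b)) else 0)"
  by (auto simp: wedge_eq linear_extension_single mult_ac)

lemma wedge_add_right: "v \<and>\<^sub>e (w + w') = v \<and>\<^sub>e w + v \<and>\<^sub>e w'"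
  by (rule module_hom.add[OF lin_wedge_right])

lemma wedge_scale_left: "free_scale c v \<and>\<^sub>e w = free_scale c (v \<and>\<^sub>e w)"
  by (rule module_hom.scale[OF lin_wedge_left])

lemma wedge_scale_right: "v \<and>\<^sub>e free_scale c w = free_scale c (v \<and>\<^sub>e w)"
  by (rule module_hom.scale[OF lin_wedge_right])

lemma wedge_sum_left: "sum g B \<and>\<^sub>e w = (\<Sum>b\<in>B. g b \<and>\<^sub>e w)"
  by (rule module_hom.sum[OF lin_wedge_left])

lemma wedge_sum_right: "v \<and>\<^sub>e sum g B = (\<Sum>b\<in>B. v \<and>\<^sub>e g b)"
  by (rule module_hom.sum[OF lin_wedge_right])

lemma wedge_zero_left [simp]: "0 \<and>\<^sub>e w = 0"
  by (rule module_hom.zero[OF lin_wedge_left])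

lemma wedge_zero_right [simp]: "v \<and>\<^sub>e 0 = 0"
  by (rule module_hom.zero[OF lin_wedge_right])

section \<open>Signs and the exterior algebra\<close>

abbreviation sgn_inv :: "'n::linorder set \<Rightarrow> 'n set \<Rightarrow> 'r::comm_ring_1" where
  "sgn_inv I J \<equiv> (-1) ^ inversions I J"

lemma sgn_inv_square_left [simp]: "sgn_inv I J * (sgn_inv I J * a) = (a :: 'r::comm_ring_1)"
  by (simp flip: mult.assoc)

lemma inversions_empty [simp]: "inversions {} J = 0" "inversions I {} = 0"
  by (simp_all add: inversions_def)

lemma finite_inversions:
  "finite {(a, b). a \<in> I \<and> b \<in> J \<and> b < a}" if "finite I" "finite J"
  by (rule finite_subset[of _ "I \<times> J"]) (use that in auto)

lemma inversions_Un_left: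
  fixes I I' J :: "'n::{finite, linorder} set"
  assumes "I \<inter> I' = {}"
  shows "inversions (I \<union> I') J = inversions I J + inversions I' J"
proof -
  have "{(a, b). a \<in> I \<union> I' \<and> b \<in> J \<and> b < a} =
      {(a, b). a \<in> I \<and> b \<in> J \<and> b < a} \<union> {(a, b). a \<in> I' \<and> b \<in> J \<and> b < a}"
    by auto
  then show ?thesis
    unfolding inversions_def using assms by (simp add: card_Un_disjoint disjoint_iff finite_inversions)
qed

lemma inversions_Un_right:
  fixes I J J' :: "'n::{finite, linorder} set"
  assumes "J \<inter> J' = {}"
  shows "inversions I (J \<union> J') = inversions I J + inversions I J'"
proof -
  have "{(a, b). a \<in> I \<and> b \<in> J \<union> J' \<and> b < a} =
      {(a, b). a \<in> I \<and> b \<in> J \<and> b < a} \<union> {(a, b). a \<in> I \<and> b \<in> J' \<and> b < a}"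
    by auto
  then show ?thesis
    unfolding inversions_def using assms by (simp add: card_Un_disjoint disjoint_iff finite_inversions)
qed

lemma inversions_insert_left:
  "j \<notin> I \<Longrightarrow> inversions (insert j I) J = inversions {j} J + inversions I J"
  for I :: "'n::{finite, linorder} set"
  using inversions_Un_left[of "{j}" I J] by simp

lemma inversions_insert_right:
  "j \<notin> J \<Longrightarrow> inversions I (insert j J) = inversions I {j} + inversions I J"
  for I :: "'n::{finite, linorder} set"
  using inversions_Un_right[of "{j}" J I] by simp

lemma inversions_same [simp]: "inversions {j} {j} = 0"
proof -
  have "{(a, b). a \<in> {j} \<and> b \<in> {j} \<and> b < a} = {}" by auto
  then show ?thesis by (simp only: inversions_def card.empty)
qed

text \<open>Of two distinct indices exactly one order is an inversion, so each pair is counted once.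
  This is graded commutativity on the level of exponents.\<close>

lemma inversions_swap:
  fixes I J :: "'n::{finite, linorder} set"
  assumes "I \<inter> J = {}"
  shows "inversions I J + inversions J I = card I * card J"
proof -
  have "I \<times> J = {(a, b). a \<in> I \<and> b \<in> J \<and> b < a} \<union> prod.swap ` {(a, b). a \<in> J \<and> b \<in> I \<and> b < a}"
    using assms by (auto simp: image_iff disjoint_iff) (metis linorder_neqE)
  also have "card \<dots> = inversions I J + inversions J I"
    unfolding inversions_def
    by (subst card_Un_disjoint) (auto simp: finite_inversions card_image)
  finally show ?thesis by (simp add: card_cartesian_product)
qed

lemma sgn_inv_swap:
  fixes I J :: "'n::{finite, linorder} set"
  assumes "I \<inter> J = {}"
  shows "(sgn_inv I J :: 'r::comm_ring_1) = (-1) ^ (card I * card J) * sgn_inv J I"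
  by (simp add: power_add mult.assoc flip: inversions_swap[OF assms])

text \<open>On basis elements both sides carry the exponent inv(I,J) + inv(I,K) + inv(J,K), since
  \<open>inversions\<close> is additive over disjoint unions in either argument.\<close>

lemma wedge_assoc: "(u \<and>\<^sub>e v) \<and>\<^sub>e w = u \<and>\<^sub>e v \<and>\<^sub>e w"
proof (rule lin_eqI[where v = u])
  show "lin (\<lambda>u. (u \<and>\<^sub>e v) \<and>\<^sub>e w)" "lin (\<lambda>u. u \<and>\<^sub>e v \<and>\<^sub>e w)"
    by (intro lin_compose[OF lin_wedge_left] lin_wedge_left)+
  fix I
  show "(Poly_Mapping.single I 1 \<and>\<^sub>e v) \<and>\<^sub>e w = Poly_Mapping.single I 1 \<and>\<^sub>e v \<and>\<^sub>e w"
  proof (rule lin_eqI[where v = v])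
    show "lin (\<lambda>v. (Poly_Mapping.single I 1 \<and>\<^sub>e v) \<and>\<^sub>e w)" "lin (\<lambda>v. Poly_Mapping.single I 1 \<and>\<^sub>e v \<and>\<^sub>e w)"
      by (rule lin_compose[OF lin_wedge_left lin_wedge_right] lin_compose[OF lin_wedge_right lin_wedge_left])+
    fix J
    show "(Poly_Mapping.single I 1 \<and>\<^sub>e Poly_Mapping.single J 1) \<and>\<^sub>e w =
        Poly_Mapping.single I 1 \<and>\<^sub>e Poly_Mapping.single J 1 \<and>\<^sub>e w"
    proof (rule lin_eqI[where v = w])
      show "lin (\<lambda>w. (Poly_Mapping.single I 1 \<and>\<^sub>e Poly_Mapping.single J 1) \<and>\<^sub>e w)"
        "lin (\<lambda>w. Poly_Mapping.single I 1 \<and>\<^sub>e Poly_Mapping.single J 1 \<and>\<^sub>e w)"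
        by (intro lin_compose[OF lin_wedge_right] lin_wedge_right)+
      fix K
      show "(Poly_Mapping.single I 1 \<and>\<^sub>e Poly_Mapping.single J 1) \<and>\<^sub>e Poly_Mapping.single K 1 =
        Poly_Mapping.single I 1 \<and>\<^sub>e Poly_Mapping.single J 1 \<and>\<^sub>e Poly_Mapping.single K 1"
        by (auto simp: wedge_single Int_Un_distrib Int_Un_distrib2 inversions_Un_left
            inversions_Un_right power_add Un_assoc mult_ac)
    qed
  qed
qed

lemma wedge_one_left: "ext_basis {} \<and>\<^sub>e v = v"
  by (rule lin_eqI[where v = v])
    (simp_all add: lin_wedge_right lin_ident ext_basis_def wedge_single)

lemma wedge_one_right: "v \<and>\<^sub>e ext_basis {} = v"
  by (rule lin_eqI[where v = v])
    (simp_all add: lin_wedge_left lin_ident ext_basis_def wedge_single)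

lemma wedge_anticommute_basis:
  "ext_basis {i} \<and>\<^sub>e ext_basis {j} \<and>\<^sub>e v = - (ext_basis {j} \<and>\<^sub>e ext_basis {i} \<and>\<^sub>e v)"
  by (cases "i = j")
    (auto simp: ext_basis_def wedge_single sgn_inv_swap[of "{i}" "{j}"] insert_commute
      module_hom.neg[OF lin_wedge_left] single_uminus simp flip: wedge_assoc)

text \<open>The element W of the overview; \<open>U l\<close> is its part supported on the indices
  above \<open>l\<close>.\<close>

definition split_form :: "('n::{finite, linorder}, 'k::field) ext" where
  "split_form = (\<Sum>j\<in>UNIV. free_scale (split_at j) (ext_basis {j}))"

lemma split_form_U_anticommute:
  "split_form \<and>\<^sub>e U l \<and>\<^sub>e v = - (U l \<and>\<^sub>e split_form \<and>\<^sub>e v)"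
proof -
  have "split_form \<and>\<^sub>e U l \<and>\<^sub>e v = (\<Sum>j\<in>{l<..}. \<Sum>i\<in>UNIV.
      free_scale (split_at i) (free_scale (split_at j) (ext_basis {i} \<and>\<^sub>e ext_basis {j} \<and>\<^sub>e v)))"
    by (simp only: split_form_def U_def wedge_sum_left wedge_sum_right wedge_scale_left
        wedge_scale_right free.scale_sum_right) (simp add: mult.commute)
  also have "\<dots> = (\<Sum>j\<in>{l<..}. \<Sum>i\<in>UNIV.
      - free_scale (split_at i) (free_scale (split_at j) (ext_basis {j} \<and>\<^sub>e ext_basis {i} \<and>\<^sub>e v)))"
    by (intro sum.cong refl, subst wedge_anticommute_basis) simp
  also have "\<dots> = - (U l \<and>\<^sub>e split_form \<and>\<^sub>e v)"
    by (simp only: split_form_def U_def wedge_sum_left wedge_sum_right wedge_scale_left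
        wedge_scale_right free.scale_sum_right sum_negf) (subst sum.swap, rule refl)
  finally show ?thesis .
qed

section \<open>Computations in the enveloping algebra\<close>

lemma pairs_class_eq_iff: "pairs_class u = pairs_class v \<longleftrightarrow> u - v \<in> bilinear_relations"
  by (rule nc_env.abs_eq_iff)

lemma tensor_mult: "(a \<otimes> b) * (a' \<otimes> b') = (a * a') \<otimes> (b * b')"
  by (simp add: tensor_def times_nc_env.abs_eq pair_mult_pair)

lemma tensor_add_left: "(a + a') \<otimes> b = a \<otimes> b + a' \<otimes> b"
  using bilinear_relations.add_left[of a a' b]
  by (simp add: tensor_def plus_nc_env.abs_eq pairs_class_eq_iff diff_diff_eq)

lemma tensor_0_left: "0 \<otimes> b = 0"
  using tensor_add_left[of 0 0 b] by simp

lemma tensor_uminus_left: "(- a) \<otimes> b = - (a \<otimes> b)"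
  using tensor_add_left[of a "- a" b] by (simp add: tensor_0_left eq_neg_iff_add_eq_0 add.commute)

lemma tensor_sign_left: "((-1) ^ m * a) \<otimes> b = (-1) ^ m * (a \<otimes> b)"
  by (induction m) (simp_all add: tensor_uminus_left)

lemma prod_xvar_UNIV: "(\<Prod>i\<in>UNIV. xvar i) = (0 :: ('n::finite, 'k::field) nc_alg)"
  by (simp add: prod_xvar zero_nc_alg_def poly_class_eq_iff flip: all_vars_def)

definition xdiff :: "'n::{finite, linorder} \<Rightarrow> ('n, 'k::field) nc_env" where
  "xdiff i = 1 \<otimes> xvar i - xvar i \<otimes> 1"

text \<open>The summand at j is x_{<j} \<otimes> x_{\<ge>j} minus x_{\<le>j} \<otimes> x_{>j}, so
  consecutive terms cancel. Stating it for upper sets lets the induction add a new minimum; the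
  empty set is the base case because x_1...x_n = 0 in A.\<close>

lemma split_at_mult_xdiff_telescope:
  fixes D :: "'n::{finite, linorder} set"
  assumes "\<And>a b. a \<in> D \<Longrightarrow> a \<le> b \<Longrightarrow> b \<in> D"
  shows "(\<Sum>j\<in>D. split_at j * xdiff j) = ((\<Prod>i\<in>-D. xvar i) \<otimes> (\<Prod>i\<in>D. xvar i) :: ('n, 'k::field) nc_env)"
  using finite[of D] assms
proof (induction D rule: finite_linorder_min_induct)
  case empty
  show ?case by (simp add: prod_xvar_UNIV tensor_0_left)
next
  case (insert b A)
  have A: "A = {b<..}"
  proof
    show "A \<subseteq> {b<..}" using insert.hyps by auto
    show "{b<..} \<subseteq> A"
    proof
      fix x assume "x \<in> {b<..}"
      then show "x \<in> A" using insert.prems[of b x] less_imp_le[of b x] by auto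
    qed
  qed
  have IH: "(\<Sum>j\<in>A. split_at j * xdiff j) = (\<Prod>i\<in>-A. xvar i) \<otimes> (\<Prod>i\<in>A. xvar i :: ('n, 'k) nc_alg)"
    by (rule insert.IH) (auto simp: A)
  have compl: "- A = insert b {..<b}" "- insert b A = {..<b}"
    by (auto simp: A)
  have "split_at b * xdiff b = (\<Prod>i\<in>{..<b}. xvar i) \<otimes> (\<Prod>i\<in>insert b A. xvar i)
      - (\<Prod>i\<in>insert b {..<b}. xvar i) \<otimes> (\<Prod>i\<in>A. xvar i :: ('n, 'k) nc_alg)"
    by (simp add: split_at_def xdiff_def right_diff_distrib tensor_mult mult.commute A)
  then show ?case
    unfolding compl using insert.hyps IH by (subst sum.insert) (auto simp: compl)
qed

text \<open>This is \<delta>(U_l). The surviving x_l sits in the left tensor factor, where the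
  quotients of the values of f are placed, so a quotient can absorb it.\<close>

lemma sum_split_at_mult_xdiff:
  "(\<Sum>j\<in>{l<..}. split_at j * xdiff j) = split_at l * (xvar l \<otimes> 1)"
proof -
  have compl: "- {l<..} = {..l}" "{..l} = insert l {..<l}" by auto
  show ?thesis
    by (subst split_at_mult_xdiff_telescope)
      (auto simp: compl split_at_def tensor_mult mult.commute)
qed

section \<open>The differential as contraction plus multiplication\<close>

text \<open>Indexed by elements instead of positions: \<open>inversions {i} I\<close> counts the
  elements of \<open>I\<close> below \<open>i\<close>, which is j - 1 for i = i_j.\<close>

definition contraction :: "('n::{finite, linorder}, 'k::field) ext \<Rightarrow> ('n, 'k) ext" where
  "contraction = linear_extension
     (\<lambda>I. \<Sum>i\<in>I. Poly_Mapping.single (I - {i}) (sgn_inv {i} I * xdiff i))"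

lemma lin_contraction: "lin contraction"
  unfolding contraction_def by (rule lin_linear_extension)

lemma contraction_single: "contraction (Poly_Mapping.single I c) =
    (\<Sum>i\<in>I. Poly_Mapping.single (I - {i}) (c * (sgn_inv {i} I * xdiff i)))"
  by (simp add: contraction_def linear_extension_single free.scale_sum_right)

lemma sgn_inv_Diff_right:
  fixes I J :: "'n::{finite, linorder} set"
  assumes "i \<in> I"
  shows "(sgn_inv J I :: 'r::comm_ring_1) = sgn_inv J {i} * sgn_inv J (I - {i})"
  using inversions_insert_right[of i "I - {i}" J] assms
  by (simp add: insert_absorb power_add)

text \<open>Contracting e_j itself gives the first term; every other contraction has to pass e_j,
  whence the minus sign.\<close>

lemma contraction_ext_basis_wedge:
  fixes w :: "('n::{finite, linorder}, 'k::field) ext"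
  shows "contraction (ext_basis {j} \<and>\<^sub>e w) = free_scale (xdiff j) w - ext_basis {j} \<and>\<^sub>e contraction w"
proof (rule lin_eqI[where v = w])
  show "lin (\<lambda>w. contraction (ext_basis {j} \<and>\<^sub>e w))"
    by (intro lin_compose[OF lin_contraction] lin_wedge_right)
  show "lin (\<lambda>w. free_scale (xdiff j) w - ext_basis {j} \<and>\<^sub>e contraction w)"
    by (intro lin_diff lin_scale lin_ident lin_compose[OF lin_wedge_right] lin_contraction)
next
  fix I :: "'n set"
  show "contraction (ext_basis {j} \<and>\<^sub>e Poly_Mapping.single I 1) =
      free_scale (xdiff j :: ('n, 'k) nc_env) (Poly_Mapping.single I 1) -
      ext_basis {j} \<and>\<^sub>e contraction (Poly_Mapping.single I 1)"
  proof (cases "j \<in> I")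
    case True
    \<comment> \<open>The left side is 0. On the right only i = j survives, since e_j \<and> e_{I -
      {i}} = 0 for every other i, and it cancels the first term.\<close>
    have "ext_basis {j} \<and>\<^sub>e contraction (Poly_Mapping.single I 1) =
        (\<Sum>i\<in>I. if i = j then Poly_Mapping.single I (xdiff j :: ('n, 'k) nc_env) else 0)"
      unfolding contraction_single wedge_sum_right using True
      by (intro sum.cong refl)
        (auto simp: ext_basis_def wedge_single sgn_inv_Diff_right[OF True, of "{j}"] insert_absorb)
    then show ?thesis
      using True by (simp add: ext_basis_def wedge_single module_hom.zero[OF lin_contraction])
  next
    case False
    have "Poly_Mapping.single (insert j I - {i}) (sgn_inv {j} I * (sgn_inv {i} (insert j I) * xdiff i)) =
        - (ext_basis {j} \<and>\<^sub>e Poly_Mapping.single (I - {i}) (sgn_inv {i} I * xdiff i :: ('n, 'k) nc_env))"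
      if "i \<in> I" for i
    proof -
      have "i \<noteq> j" using that False by auto
      \<comment> \<open>One of i and j precedes the other, so exactly one of the two exponents is
        1.\<close>
      then have "(sgn_inv {i} {j} :: ('n, 'k) nc_env) * sgn_inv {j} {i} = -1"
        using inversions_swap[of "{i}" "{j}"] by (simp flip: power_add)
      note ij = this
      have "(sgn_inv {j} I * sgn_inv {i} (insert j I) :: ('n, 'k) nc_env) =
          (sgn_inv {i} {j} * sgn_inv {j} {i}) * (sgn_inv {j} (I - {i}) * sgn_inv {i} I)"
        unfolding sgn_inv_Diff_right[OF that, of "{j}"] inversions_insert_right[OF False] power_add
        by (simp only: mult_ac)
      also have "\<dots> = - (sgn_inv {j} (I - {i}) * sgn_inv {i} I)"
        by (simp add: ij)
      finally have "sgn_inv {j} I * (sgn_inv {i} (insert j I) * xdiff i) =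
          - (sgn_inv {j} (I - {i}) * (sgn_inv {i} I * xdiff i :: ('n, 'k) nc_env))"
        by (simp only: mult_minus_left mult.assoc[symmetric])
      then show ?thesis
        unfolding ext_basis_def
        using \<open>i \<noteq> j\<close> False by (simp only: wedge_single) (simp add: single_uminus insert_Diff_if)
    qed
    note summand = this
    have "insert j I - {j} = I" using False by auto
    then have "contraction (ext_basis {j} \<and>\<^sub>e Poly_Mapping.single I (1 :: ('n, 'k) nc_env)) =
        Poly_Mapping.single I (xdiff j) +
        (\<Sum>i\<in>I. Poly_Mapping.single (insert j I - {i}) (sgn_inv {j} I * (sgn_inv {i} (insert j I) * xdiff i)))"
      using False by (simp add: ext_basis_def wedge_single contraction_single
          inversions_insert_right[OF False])
    also have "\<dots> = Poly_Mapping.single I (xdiff j) -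
        ext_basis {j} \<and>\<^sub>e contraction (Poly_Mapping.single I 1)"
      by (simp add: summand contraction_single wedge_sum_right sum_negf)
    finally show ?thesis by simp
  qed
qed

lemma contraction_U_wedge:
  "contraction (U l \<and>\<^sub>e w) = free_scale (split_at l * (xvar l \<otimes> 1)) w - U l \<and>\<^sub>e contraction w"
proof -
  have "contraction (U l \<and>\<^sub>e w) = (\<Sum>j\<in>{l<..}. free_scale (split_at j * xdiff j) w
      - free_scale (split_at j) (ext_basis {j} \<and>\<^sub>e contraction w))"
    by (simp add: U_def wedge_sum_left wedge_scale_left module_hom.sum[OF lin_contraction]
        module_hom.scale[OF lin_contraction] contraction_ext_basis_wedge free.scale_right_diff_distrib)
  also have "\<dots> = free_scale (\<Sum>j\<in>{l<..}. split_at j * xdiff j) w - U l \<and>\<^sub>e contraction w"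
    by (simp add: sum_subtractf U_def wedge_sum_left wedge_scale_left free.scale_sum_left)
  finally show ?thesis by (simp only: sum_split_at_mult_xdiff)
qed

section \<open>Positions and elements of an index set\<close>

lemma bij_betw_nth_elem: "bij_betw (nth_elem I) {1..card I} I" if "finite I"
proof -
  let ?xs = "sorted_list_of_set I"
  have "bij_betw ((!) ?xs) {..<length ?xs} (set ?xs)"
    by (rule bij_betw_nth) auto
  moreover have "bij_betw (\<lambda>j. j - 1) {1..card I} {..<length ?xs}"
    by (rule bij_betw_byWitness[where f' = Suc]) auto
  ultimately have "bij_betw ((!) ?xs \<circ> (\<lambda>j. j - 1)) {1..card I} (set ?xs)"
    by (rule bij_betw_trans[rotated])
  moreover have "(!) ?xs \<circ> (\<lambda>j. j - 1) = nth_elem I"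
    by (simp add: fun_eq_iff nth_elem_def)
  ultimately show ?thesis using that by simp
qed

lemma nth_elem_less_iff:
  assumes "finite I" "a \<in> {1..card I}" "b \<in> {1..card I}"
  shows "nth_elem I a < nth_elem I b \<longleftrightarrow> a < b"
proof -
  have "nth_elem I a < nth_elem I b" if "a < b" "a \<in> {1..card I}" "b \<in> {1..card I}" for a b
    using that \<open>finite I\<close> sorted_wrt_nth_less[of "(<)" "sorted_list_of_set I" "a - 1" "b - 1"]
    by (simp add: nth_elem_def)
  from this[of a b] this[of b a] show ?thesis
    using assms by (cases a b rule: linorder_cases) auto
qed

lemma inversions_nth_elem:
  fixes I :: "'n::{finite, linorder} set"
  assumes "j \<in> {1..card I}"
  shows "inversions {nth_elem I j} I = j - 1"
proof -
  have I: "nth_elem I ` {1..card I} = I"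
    by (rule bij_betw_imp_surj_on[OF bij_betw_nth_elem]) simp
  have "{b \<in> I. b < nth_elem I j} = nth_elem I ` {1..<j}"
  proof safe
    fix b assume "b \<in> I" "b < nth_elem I j"
    then obtain a where "a \<in> {1..card I}" "b = nth_elem I a" by (metis I imageE)
    with \<open>b < nth_elem I j\<close> show "b \<in> nth_elem I ` {1..<j}"
      using assms nth_elem_less_iff[of I a j] by simp
  next
    fix a assume "a \<in> {1..<j}"
    then have a: "a \<in> {1..card I}" "a < j" using assms by auto
    then show "nth_elem I a \<in> I" using I by blast
    show "nth_elem I a < nth_elem I j" using a assms nth_elem_less_iff[of I a j] by simp
  qed
  moreover have "inj_on (nth_elem I) {1..<j}"
    by (rule inj_on_subset[OF bij_betw_imp_inj_on[OF bij_betw_nth_elem[of I]]]) (use assms in auto)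
  moreover have "{(a, b). a \<in> {nth_elem I j} \<and> b \<in> I \<and> b < a} =
      Pair (nth_elem I j) ` {b \<in> I. b < nth_elem I j}"
    by auto
  ultimately show ?thesis
    by (simp add: inversions_def card_image inj_on_def)
qed

text \<open>The bijection \<open>nth_elem I\<close> turns the positions of \<open>diff_basis\<close>
  into elements; the conditional is the omission of the second sum at t^(0).\<close>

lemma dF_times_t:
  "dF (w \<cdot>t u) = contraction w \<cdot>t u + (if u = 0 then 0 else (split_form \<and>\<^sub>e w) \<cdot>t (u - 1))"
proof (rule lin_eqI[where v = w])
  show "lin (\<lambda>w. dF (w \<cdot>t u))"
    by (intro lin_compose[OF lin_dF] lin_times_t)
  show "lin (\<lambda>w. contraction w \<cdot>t u + (if u = 0 then 0 else (split_form \<and>\<^sub>e w) \<cdot>t (u - 1)))"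
    by (intro lin_add lin_if lin_zero lin_compose[OF lin_times_t] lin_contraction lin_wedge_right)
next
  fix I :: "'a set"
  have "(\<Sum>j = 1..card I. free_scale ((-1) ^ (j - 1) * (1 \<otimes> xvar (nth_elem I j) - xvar (nth_elem I j) \<otimes> 1))
          (ext_basis (I - {nth_elem I j}) \<cdot>t u)) =
      (\<Sum>j = 1..card I. Poly_Mapping.single (I - {nth_elem I j}, u)
        (sgn_inv {nth_elem I j} I * xdiff (nth_elem I j)) :: ('a, 'b) res)"
    by (rule sum.cong) (simp_all add: ext_basis_times_t inversions_nth_elem xdiff_def)
  also have "\<dots> = (\<Sum>i\<in>I. Poly_Mapping.single (I - {i}, u) (sgn_inv {i} I * xdiff i))"
    by (rule sum.reindex_bij_betw[OF bij_betw_nth_elem[OF finite]])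
  also have "\<dots> = contraction (Poly_Mapping.single I 1) \<cdot>t u"
    by (simp add: contraction_single module_hom.sum[OF lin_times_t] times_t_single)
  finally have 1: "(\<Sum>j = 1..card I. free_scale ((-1) ^ (j - 1) *
        (1 \<otimes> xvar (nth_elem I j) - xvar (nth_elem I j) \<otimes> 1))
          (ext_basis (I - {nth_elem I j}) \<cdot>t u)) =
      (contraction (Poly_Mapping.single I 1) \<cdot>t u :: ('a, 'b) res)" .
  have 2: "(\<Sum>j\<in>UNIV. free_scale (split_at j) ((ext_basis {j} \<and>\<^sub>e ext_basis I) \<cdot>t (u - 1))) =
      ((split_form \<and>\<^sub>e Poly_Mapping.single I 1) \<cdot>t (u - 1) :: ('a, 'b) res)"
    by (simp only: split_form_def wedge_sum_left wedge_scale_left module_hom.sum[OF lin_times_t]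
        module_hom.scale[OF lin_times_t] ext_basis_def[of I])
  have "dF (Poly_Mapping.single I 1 \<cdot>t u) = (diff_basis (I, u) :: ('a, 'b) res)"
    by (simp add: dF_def times_t_single linear_extension_single)
  then show "dF (Poly_Mapping.single I 1 \<cdot>t u) = contraction (Poly_Mapping.single I 1) \<cdot>t u +
      (if u = 0 then 0 else (split_form \<and>\<^sub>e Poly_Mapping.single I 1) \<cdot>t (u - 1) :: ('a, 'b) res)"
    unfolding diff_basis_def prod.case 1 2 .
qed

section \<open>Products in decreasing order\<close>

lemma sorted_list_of_set_insert_Max:
  assumes "finite A" "\<And>a. a \<in> A \<Longrightarrow> a < b"
  shows "sorted_list_of_set (insert b A) = sorted_list_of_set A @ [b]"
  by (rule sorted_list_of_set_unique[THEN iffD1])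
    (use assms in \<open>auto simp: sorted_wrt_append card_insert_if\<close>)

text \<open>In decreasing order the largest factor stands first, so the inductions below add a new
  maximum and multiply on the left.\<close>

lemma wedge_list_rev_sorted_insert_Max:
  assumes "finite A" "\<And>a. a \<in> A \<Longrightarrow> a < b"
  shows "wedge_list (map g (rev (sorted_list_of_set (insert b A)))) =
    g b \<and>\<^sub>e wedge_list (map g (rev (sorted_list_of_set A)))"
  by (simp add: sorted_list_of_set_insert_Max[OF assms] wedge_list_def)

definition U_desc :: "'n::{finite, linorder} set \<Rightarrow> ('n, 'k::field) ext" where
  "U_desc L = wedge_list (map U (rev (sorted_list_of_set L)))"

lemma U_desc_empty: "U_desc {} = ext_basis {}"
  by (simp add: U_desc_def wedge_list_def)

lemma U_desc_insert_Max: "(\<And>a. a \<in> A \<Longrightarrow> a < b) \<Longrightarrow> U_desc (insert b A) = U b \<and>\<^sub>e U_desc A"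
  unfolding U_desc_def by (rule wedge_list_rev_sorted_insert_Max) simp_all

text \<open>W has degree one and passes |L| factors of degree one.\<close>

lemma split_form_wedge_U_desc:
  "split_form \<and>\<^sub>e U_desc L \<and>\<^sub>e w = free_scale ((-1) ^ card L) (U_desc L \<and>\<^sub>e split_form \<and>\<^sub>e w)"
  using finite[of L]
proof (induction L rule: finite_linorder_max_induct)
  case empty
  show ?case by (simp add: U_desc_empty wedge_one_left)
next
  case (insert b A)
  have "b \<notin> A" using insert.hyps by auto
  then show ?case
    using insert.hyps
    by (simp add: U_desc_insert_Max wedge_assoc split_form_U_anticommute insert.IH
        wedge_scale_right)
qed

text \<open>The antiderivation rule, factor by factor. To contract U_l one passes the factors on its
  left; they belong to the elements of L above l, and \<open>inversions L {l}\<close> counts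
  these.\<close>

lemma contraction_U_desc_wedge:
  "contraction (U_desc L \<and>\<^sub>e w) =
     (\<Sum>l\<in>L. free_scale (sgn_inv L {l} * (split_at l * (xvar l \<otimes> 1))) (U_desc (L - {l}) \<and>\<^sub>e w))
     + free_scale ((-1) ^ card L) (U_desc L \<and>\<^sub>e contraction w)"
  using finite[of L]
proof (induction L rule: finite_linorder_max_induct)
  case empty
  show ?case by (simp add: U_desc_empty wedge_one_left)
next
  case (insert b A)
  have "b \<notin> A" using insert.hyps by auto
  have b: "sgn_inv (insert b A) {b} = (1 :: ('a, 'b) nc_env)"
  proof -
    have "{(x, y). x \<in> insert b A \<and> y \<in> {b} \<and> y < x} = {}" using insert.hyps by fastforce
    then show ?thesis by (simp only: inversions_def card.empty power_0)
  qed
  \<comment> \<open>The factor U_b stands to the left of all older ones and adds one to each of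
    their exponents.\<close>
  have A: "sgn_inv (insert b A) {l} = - (sgn_inv A {l} :: ('a, 'b) nc_env)"
    "U_desc (insert b A - {l}) = U b \<and>\<^sub>e (U_desc (A - {l}) :: ('a, 'b) ext)" if "l \<in> A" for l
  proof -
    have "l < b" using insert.hyps that by auto
    then have "{(x, y). x \<in> {b} \<and> y \<in> {l} \<and> y < x} = {(b, l)}" by auto
    then have "inversions {b} {l} = 1" by (simp only: inversions_def) simp
    then show "sgn_inv (insert b A) {l} = - (sgn_inv A {l} :: ('a, 'b) nc_env)"
      by (simp add: inversions_insert_left[OF \<open>b \<notin> A\<close>])
    show "U_desc (insert b A - {l}) = U b \<and>\<^sub>e (U_desc (A - {l}) :: ('a, 'b) ext)"
      using \<open>l < b\<close> insert.hyps U_desc_insert_Max[of "A - {l}" b] by (auto simp: insert_Diff_if)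
  qed
  show ?case
    using insert.hyps \<open>b \<notin> A\<close>
    by (simp add: U_desc_insert_Max wedge_assoc contraction_U_wedge insert.IH A b
        wedge_add_right wedge_sum_right wedge_scale_right sum_negf)
qed

text \<open>Positions start at 1, so the exponent j_1 + ... + j_r - r is a genuine difference of
  natural numbers.\<close>

lemma card_le_sum_positive:
  fixes P :: "nat set"
  assumes "P \<subseteq> {1..m}"
  shows "card P \<le> \<Sum>P"
  unfolding card_eq_sum by (rule sum_mono) (use assms in auto)

text \<open>Let J consist of the i_j with j in P. The exponent, the sum of j - 1 over P, counts for
  each member of J the elements of I below it. Those in J pay for reordering the decreasing product
  into e_J; those in I - J remain as the sign of e_J \<otimes> e_{I - J} in the coproduct.\<close>

lemma sign_mult_ext_seq:
  fixes I :: "'n::{finite, linorder} set"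
  assumes "P \<subseteq> {1..card I}"
  shows "free_scale ((-1) ^ (\<Sum>P - card P)) (ext_seq (map (nth_elem I) (rev (sorted_list_of_set P)))) =
    (Poly_Mapping.single (nth_elem I ` P) (sgn_inv (nth_elem I ` P) (I - nth_elem I ` P)) :: ('n, 'k::field) ext)"
  using finite_subset[OF assms finite_atLeastAtMost] assms
proof (induction P rule: finite_linorder_max_induct)
  case empty
  show ?case by (simp add: ext_seq_def wedge_list_def ext_basis_def)
next
  case (insert p P)
  define n where "n = nth_elem I p"
  define J where "J = nth_elem I ` P"
  define K where "K = I - insert n J"
  have less: "a < n" if "a \<in> J" for a
    using that insert nth_elem_less_iff[of I _ p] by (force simp: J_def n_def)
  then have "n \<notin> J" by blast
  have sub: "J \<subseteq> I" "n \<in> I"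
    using insert.prems bij_betw_imp_surj_on[OF bij_betw_nth_elem[of I]] by (auto simp: J_def n_def)
  \<comment> \<open>The new index n exceeds all of J, so moving it out of I - J changes no inversion
    of the old part.\<close>
  have "inversions J {n} = 0"
  proof -
    have "{(x, y). x \<in> J \<and> y \<in> {n} \<and> y < x} = {}" using less by fastforce
    then show ?thesis by (simp only: inversions_def card.empty)
  qed
  moreover have "I - J = insert n K" using sub \<open>n \<notin> J\<close> by (auto simp: K_def)
  ultimately have 1: "inversions J (I - J) = inversions J K"
    using inversions_insert_right[of n K J] by (simp add: K_def)
  have "inversions {n} I = inversions {n} J + inversions {n} K"
  proof -
    have "I = insert n (J \<union> K)" using sub by (auto simp: K_def)
    then have "inversions {n} I = inversions {n} (insert n (J \<union> K))" by simp
    also have "\<dots> = inversions {n} J + inversions {n} K"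
      using \<open>n \<notin> J\<close> by (subst inversions_insert_right)
        (auto simp: K_def intro!: inversions_Un_right)
    finally show ?thesis .
  qed
  \<comment> \<open>The contribution p - 1 of the new position splits: the part in J is used up by
    sorting e_n \<and> e_J, the part in K is the growth of the coproduct sign.\<close>
  then have 2: "p - 1 = inversions {n} J + inversions {n} K"
    using insert.prems by (simp add: n_def inversions_nth_elem)
  have 3: "inversions (insert n J) K = inversions {n} K + inversions J K"
    by (rule inversions_insert_left[OF \<open>n \<notin> J\<close>])
  have "p \<notin> P" using insert.hyps by auto
  have "card P \<le> \<Sum>P"
    using insert.prems by (intro card_le_sum_positive) auto
  then have 4: "\<Sum>(insert p P) - card (insert p P) = (p - 1) + (\<Sum>P - card P)"
    using \<open>p \<notin> P\<close> insert.hyps insert.prems by simp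
  have 5: "ext_seq (map (nth_elem I) (rev (sorted_list_of_set (insert p P)))) =
      ext_basis {n} \<and>\<^sub>e (ext_seq (map (nth_elem I) (rev (sorted_list_of_set P))) :: ('n, 'k) ext)"
    unfolding ext_seq_def map_map using insert.hyps
    by (subst wedge_list_rev_sorted_insert_Max) (simp_all add: n_def)
  have 6: "free_scale ((-1) ^ (\<Sum>P - card P)) (ext_seq (map (nth_elem I) (rev (sorted_list_of_set P)))) =
      (Poly_Mapping.single J (sgn_inv J (I - J)) :: ('n, 'k) ext)"
    using insert.IH insert.prems by (simp add: J_def)
  have "free_scale ((-1) ^ (\<Sum>(insert p P) - card (insert p P)))
      (ext_seq (map (nth_elem I) (rev (sorted_list_of_set (insert p P))))) =
      free_scale ((-1) ^ (p - 1)) (ext_basis {n} \<and>\<^sub>e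
        (Poly_Mapping.single J (sgn_inv J (I - J)) :: ('n, 'k) ext))"
    by (simp only: 4 5 6[symmetric] power_add wedge_scale_right free.scale_scale)
  also have "\<dots> = Poly_Mapping.single (insert n J) (sgn_inv (insert n J) K)"
    using \<open>n \<notin> J\<close> by (simp add: ext_basis_def wedge_single 1 2[unfolded One_nat_def] 3 power_add mult_ac)
  finally show ?case by (simp add: J_def n_def K_def)
qed

section \<open>The coproduct of the exterior algebra\<close>

text \<open>Signs are compared through the sum of their exponents, so that
  \<open>inversions_swap\<close>, which knows only such sums, applies directly.\<close>

lemma minus_one_power_eqI: "even (p + q) \<Longrightarrow> (-1) ^ p = ((-1) ^ q :: 'r::ring_1)"
  by (cases "even p") auto

lemma minus_one_power_eq_uminusI: "odd (p + q) \<Longrightarrow> (-1) ^ p = - ((-1) ^ q :: 'r::ring_1)"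
  by (cases "even p") auto

lemma sum_Pow_insert:
  fixes g :: "'a set \<Rightarrow> 'b::comm_monoid_add"
  assumes "finite A" "j \<notin> A"
  shows "sum g (Pow (insert j A)) = (\<Sum>J\<in>Pow A. g J + g (insert j J))"
proof -
  have "inj_on (insert j) (Pow A)"
    using assms(2) by (auto simp: inj_on_def)
  moreover have "Pow A \<inter> insert j ` Pow A = {}"
    using assms(2) by auto
  ultimately show ?thesis
    using assms(1) by (simp add: Pow_insert sum.union_disjoint sum.reindex sum.distrib)
qed

text \<open>
  Up to the sign $(-1)^{ms}$ on elements of degree $m$, this is
  $w \mapsto \sum w_{(1)}\,\varphi(w_{(2)})$ for the coproduct
  $e_I\mapsto\sum_{J\subseteq I}\pm e_J\otimes e_{I\smallsetminus J}$ of the exterior algebra.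
\<close>

definition cap :: "nat \<Rightarrow> ('n::{finite, linorder} set \<Rightarrow> ('n, 'k::field) nc_env) \<Rightarrow> ('n, 'k) ext \<Rightarrow> ('n, 'k) ext" where
  "cap s \<phi> = linear_extension (\<lambda>I. \<Sum>J\<in>Pow I.
     Poly_Mapping.single J ((-1) ^ (card I * s) * sgn_inv J (I - J) * \<phi> (I - J)))"

lemma lin_cap: "lin (cap s \<phi>)"
  unfolding cap_def by (rule lin_linear_extension)

lemma cap_single: "cap s \<phi> (Poly_Mapping.single I c) = (\<Sum>J\<in>Pow I.
     Poly_Mapping.single J (c * ((-1) ^ (card I * s) * sgn_inv J (I - J) * \<phi> (I - J))))"
  by (simp add: cap_def linear_extension_single free.scale_sum_right)

text \<open>Contraction strips a factor off the front, so by coassociativity it acts on w_(1) alone.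
  The factor (-1)^s arises because it lowers the degree m in (-1)^(ms).\<close>

lemma contraction_cap:
  "contraction (cap s \<phi> w) = free_scale ((-1) ^ s) (cap s \<phi> (contraction w))"
proof (rule lin_eqI[where v = w])
  show "lin (\<lambda>w. contraction (cap s \<phi> w))" "lin (\<lambda>w. free_scale ((-1) ^ s) (cap s \<phi> (contraction w)))"
    by (intro lin_scale lin_compose[OF lin_contraction] lin_compose[OF lin_cap] lin_contraction lin_cap)+
next
  fix I :: "'a set"
  let ?l = "\<lambda>J i. Poly_Mapping.single (J - {i}) ((-1) ^ (card I * s) * sgn_inv J (I - J) *
      \<phi> (I - J) * (sgn_inv {i} J * xdiff i))"
  let ?r = "\<lambda>i J. Poly_Mapping.single J ((-1) ^ s * (sgn_inv {i} I * xdiff i *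
      ((-1) ^ (card (I - {i}) * s) * sgn_inv J (I - {i} - J) * \<phi> (I - {i} - J))))"
  have "contraction (cap s \<phi> (Poly_Mapping.single I 1)) = (\<Sum>J\<in>Pow I. \<Sum>i\<in>J. ?l J i)"
    by (simp add: cap_single module_hom.sum[OF lin_contraction] contraction_single)
  also have "\<dots> = (\<Sum>(J, i)\<in>(SIGMA J:Pow I. J). ?l J i)"
    by (rule sum.Sigma) auto
  \<comment> \<open>A pair i in J corresponds to (i, J - {i}). The complement K, and with it \<phi>
    K, is the same on both sides; only signs remain to be compared.\<close>
  also have "\<dots> = (\<Sum>(i, J)\<in>(SIGMA i:I. Pow (I - {i})). ?r i J)"
  proof (rule sum.reindex_bij_witness[where i = "\<lambda>(i, J). (insert i J, i)" and j = "\<lambda>(J, i). (i, J - {i})"];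
      clarify)
    fix J i assume "J \<subseteq> I" "i \<in> J"
    define K where "K = I - J"
    have K: "I - {i} - (J - {i}) = K" "I - J = K" using \<open>i \<in> J\<close> by (auto simp: K_def)
    have "inversions J K = inversions {i} K + inversions (J - {i}) K"
      using inversions_insert_left[of i "J - {i}" K] \<open>i \<in> J\<close> by (simp add: insert_absorb)
    moreover have "inversions {i} I = inversions {i} J + inversions {i} K"
      using inversions_Un_right[of J K "{i}"] \<open>J \<subseteq> I\<close> by (simp add: K_def Un_absorb1)
    moreover have "card I = Suc (card (I - {i}))"
      using \<open>J \<subseteq> I\<close> \<open>i \<in> J\<close> by (intro card.remove) auto
    ultimately have "card I * s + inversions J K + inversions {i} J =
        s + inversions {i} I + card (I - {i}) * s + inversions (J - {i}) K"
      by simp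
    then have "((-1) ^ (card I * s) * sgn_inv J K * sgn_inv {i} J :: ('a, 'b) nc_env) =
        (-1) ^ s * sgn_inv {i} I * (-1) ^ (card (I - {i}) * s) * sgn_inv (J - {i}) K"
      by (simp only: flip: power_add)
    then have "(((-1) ^ (card I * s) * sgn_inv J K * sgn_inv {i} J) * (\<phi> K * xdiff i) :: ('a, 'b) nc_env) =
        ((-1) ^ s * sgn_inv {i} I * (-1) ^ (card (I - {i}) * s) * sgn_inv (J - {i}) K) * (\<phi> K * xdiff i)"
      by (rule arg_cong)
    then show "?r i (J - {i}) = ?l J i"
      unfolding K by (simp only: mult_ac)
  qed auto
  also have "\<dots> = (\<Sum>i\<in>I. \<Sum>J\<in>Pow (I - {i}). ?r i J)"
    by (rule sum.Sigma[symmetric]) auto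
  also have "\<dots> = free_scale ((-1) ^ s) (cap s \<phi> (contraction (Poly_Mapping.single I 1)))"
    by (simp add: contraction_single module_hom.sum[OF lin_cap] cap_single free.scale_sum_right)
  finally show "contraction (cap s \<phi> (Poly_Mapping.single I 1)) = \<dots>" .
qed

text \<open>With \<phi> read as the linear functional e_S \<mapsto> \<phi> S, this is w \<mapsto>
  \<phi>(w \<and> e_j).\<close>

definition shift_form :: "'n::{finite, linorder} \<Rightarrow> ('n set \<Rightarrow> ('n, 'k::field) nc_env) \<Rightarrow> 'n set \<Rightarrow> ('n, 'k) nc_env" where
  "shift_form j \<phi> S = (if j \<in> S then 0 else sgn_inv S {j} * \<phi> (insert j S))"

text \<open>In the coproduct of e_j \<and> w the factor e_j goes to the left or to the right. On the
  right it passes w_(1), and passes w_(2) to reach the end; the resulting (-1)^m turns (-1)^(ms)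
  into (-1)^(m(s+1)). This is what the sign (-1)^(ms) is for.\<close>

lemma cap_ext_basis_wedge:
  fixes w :: "('n::{finite, linorder}, 'k::field) ext"
  shows "cap s \<phi> (ext_basis {j} \<and>\<^sub>e w) =
    free_scale ((-1) ^ s) (ext_basis {j} \<and>\<^sub>e cap s \<phi> w + cap (Suc s) (shift_form j \<phi>) w)"
proof (rule lin_eqI[where v = w])
  show "lin (\<lambda>w. cap s \<phi> (ext_basis {j} \<and>\<^sub>e w))"
    by (intro lin_compose[OF lin_cap] lin_wedge_right)
  show "lin (\<lambda>w. free_scale ((-1) ^ s) (ext_basis {j} \<and>\<^sub>e cap s \<phi> w + cap (Suc s) (shift_form j \<phi>) w))"
    by (intro lin_scale lin_add lin_compose[OF lin_wedge_right] lin_cap)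
next
  fix I :: "'n set"
  let ?e = "Poly_Mapping.single I 1 :: ('n, 'k) ext"
  show "cap s \<phi> (ext_basis {j} \<and>\<^sub>e ?e) =
    free_scale ((-1) ^ s) (ext_basis {j} \<and>\<^sub>e cap s \<phi> ?e + cap (Suc s) (shift_form j \<phi>) ?e)"
  proof (cases "j \<in> I")
    case True
    define A where "A = I - {j}"
    have I: "I = insert j A" "j \<notin> A" using True by (auto simp: A_def)
    \<comment> \<open>Here e_j \<and> e_I = 0, so the right side has to vanish: the term of the
      first sum at J cancels that of the second at \<open>insert j J\<close>.\<close>
    have zero: "ext_basis {j} \<and>\<^sub>e Poly_Mapping.single J ((-1) ^ (card I * s) * sgn_inv J (I - J) * \<phi> (I - J))
        + Poly_Mapping.single (insert j J) ((-1) ^ (card I * Suc s) * sgn_inv (insert j J) (I - insert j J)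
            * shift_form j \<phi> (I - insert j J)) = 0" if "J \<subseteq> A" for J
    proof -
      define K where "K = A - J"
      have K: "I - J = insert j K" "I - insert j J = K" "j \<notin> K" "j \<notin> J"
        using I that by (auto simp: K_def)
      have "card A = card J + card K"
        using that card_Un_disjoint[of J K] by (simp add: K_def Un_absorb1)
      then have "(inversions {j} J + card I * s + inversions J (insert j K)) +
          (card I * Suc s + inversions (insert j J) K + inversions K {j}) =
          Suc (2 * (card I * s + inversions J K + card J + card K))"
        using inversions_swap[of "{j}" J] inversions_swap[of "{j}" K] K I
          inversions_insert_left[of j J K] inversions_insert_right[of j K J]
        by simp
      then have "odd ((inversions {j} J + card I * s + inversions J (insert j K)) +
          (card I * Suc s + inversions (insert j J) K + inversions K {j}))"
        by (metis even_Suc dvd_triv_left)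
      then have "(-1) ^ (inversions {j} J + card I * s + inversions J (insert j K)) =
          - ((-1) ^ (card I * Suc s + inversions (insert j J) K + inversions K {j}) :: ('n, 'k) nc_env)"
        by (rule minus_one_power_eq_uminusI)
      then have "sgn_inv {j} J * ((-1) ^ (card I * s) * sgn_inv J (insert j K) * \<phi> (insert j K)) =
          - ((-1) ^ (card I * Suc s) * sgn_inv (insert j J) K * (sgn_inv K {j} * \<phi> (insert j K)))"
        by (simp only: power_add mult.assoc[symmetric] mult_minus_left)
      then show ?thesis
        using K by (simp only: ext_basis_def wedge_single shift_form_def) (simp add: single_uminus)
    qed
    have "ext_basis {j} \<and>\<^sub>e cap s \<phi> ?e + cap (Suc s) (shift_form j \<phi>) ?e =
       (\<Sum>J\<in>Pow (insert j A). ext_basis {j} \<and>\<^sub>e Poly_Mapping.single J ((-1) ^ (card I * s) * sgn_inv J (I - J) * \<phi> (I - J)))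
        + (\<Sum>J\<in>Pow (insert j A). Poly_Mapping.single J ((-1) ^ (card I * Suc s) * sgn_inv J (I - J)
            * shift_form j \<phi> (I - J)))"
      by (simp only: cap_single wedge_sum_right mult_1 flip: I(1))
    \<comment> \<open>The other halves are 0: e_j kills the terms of the first sum whose subset
      contains j, and \<open>shift_form j\<close> vanishes on complements that contain j.\<close>
    also have "\<dots> = (\<Sum>J\<in>Pow A. ext_basis {j} \<and>\<^sub>e Poly_Mapping.single J ((-1) ^ (card I * s) * sgn_inv J (I - J) * \<phi> (I - J)))
        + (\<Sum>J\<in>Pow A. Poly_Mapping.single (insert j J) ((-1) ^ (card I * Suc s) * sgn_inv (insert j J) (I - insert j J)
            * shift_form j \<phi> (I - insert j J)))"
      using I by (subst (1 2) sum_Pow_insert)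
        (auto simp: ext_basis_def wedge_single shift_form_def intro!: arg_cong2[where f = "(+)"] sum.cong)
    also have "\<dots> = 0"
      unfolding sum.distrib[symmetric] by (intro sum.neutral ballI zero) simp
    finally show ?thesis
      using True by (simp add: ext_basis_def wedge_single module_hom.zero[OF lin_cap])
  next
    case False
    \<comment> \<open>The two cases of a subset of \<open>insert j I\<close>: if it misses j, then
      e_j went to the second coproduct factor, otherwise to the first.\<close>
    have coeff:
      "sgn_inv {j} I * ((-1) ^ (card (insert j I) * s) * sgn_inv J (insert j I - J) * \<phi> (insert j I - J)) =
        (-1) ^ s * ((-1) ^ (card I * Suc s) * sgn_inv J (I - J) * shift_form j \<phi> (I - J))" (is ?th1)
      "sgn_inv {j} I * ((-1) ^ (card (insert j I) * s) * sgn_inv (insert j J) (insert j I - insert j J) * \<phi> (insert j I - insert j J)) =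
        (-1) ^ s * (sgn_inv {j} J * ((-1) ^ (card I * s) * sgn_inv J (I - J) * \<phi> (I - J)))" (is ?th2)
      if "J \<subseteq> I" for J
    proof -
      define K where "K = I - J"
      have K: "I - J = K" "insert j I - J = insert j K" "insert j I - insert j J = K"
        "j \<notin> K" "j \<notin> J" "J \<inter> K = {}" "I = J \<union> K"
        using False that by (auto simp: K_def)
      have card: "card I = card J + card K"
        using that card_Un_disjoint[of J K] by (simp add: K_def Un_absorb1)
      have "(inversions {j} I + card (insert j I) * s + inversions J (insert j K)) +
          (s + card I * Suc s + inversions J K + inversions K {j}) =
          2 * (s + card I * s + inversions J K + card I)"
        using inversions_swap[of "{j}" J] inversions_swap[of "{j}" K] K False card
          inversions_Un_right[of J K "{j}"] inversions_insert_right[of j K J]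
        by simp
      then have "even ((inversions {j} I + card (insert j I) * s + inversions J (insert j K)) +
          (s + card I * Suc s + inversions J K + inversions K {j}))"
        by (metis dvd_triv_left)
      then have "(-1) ^ (inversions {j} I + card (insert j I) * s + inversions J (insert j K)) =
          ((-1) ^ (s + card I * Suc s + inversions J K + inversions K {j}) :: ('n, 'k) nc_env)"
        by (rule minus_one_power_eqI)
      then show ?th1
        unfolding K(1-3) shift_form_def using K(4) by (simp only: power_add mult.assoc[symmetric] if_False)
      have "(inversions {j} I + card (insert j I) * s + inversions (insert j J) K) +
          (s + inversions {j} J + card I * s + inversions J K) =
          2 * (s + card I * s + inversions {j} I + inversions J K)"
        using K False inversions_Un_right[of J K "{j}"] inversions_insert_left[of j J K]
        by simp
      then have "even ((inversions {j} I + card (insert j I) * s + inversions (insert j J) K) +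
          (s + inversions {j} J + card I * s + inversions J K))"
        by (metis dvd_triv_left)
      then have "(-1) ^ (inversions {j} I + card (insert j I) * s + inversions (insert j J) K) =
          ((-1) ^ (s + inversions {j} J + card I * s + inversions J K) :: ('n, 'k) nc_env)"
        by (rule minus_one_power_eqI)
      then show ?th2
        unfolding K(1-3) by (simp only: power_add mult.assoc[symmetric])
    qed
    have "cap s \<phi> (ext_basis {j} \<and>\<^sub>e ?e) = cap s \<phi> (Poly_Mapping.single (insert j I) (sgn_inv {j} I))"
      using False by (simp add: ext_basis_def wedge_single)
    also have "\<dots> = (\<Sum>J\<in>Pow I.
        Poly_Mapping.single J ((-1) ^ s * ((-1) ^ (card I * Suc s) * sgn_inv J (I - J) * shift_form j \<phi> (I - J)))
        + Poly_Mapping.single (insert j J) ((-1) ^ s * (sgn_inv {j} J * ((-1) ^ (card I * s) * sgn_inv J (I - J) * \<phi> (I - J)))))"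
      unfolding cap_single sum_Pow_insert[OF finite False]
      by (rule sum.cong) (simp_all only: coeff Pow_iff)
    also have "\<dots> = free_scale ((-1) ^ s) (\<Sum>J\<in>Pow I.
        Poly_Mapping.single J ((-1) ^ (card I * Suc s) * sgn_inv J (I - J) * shift_form j \<phi> (I - J))
        + ext_basis {j} \<and>\<^sub>e Poly_Mapping.single J ((-1) ^ (card I * s) * sgn_inv J (I - J) * \<phi> (I - J)))"
      using False unfolding free.scale_sum_right
      by (intro sum.cong refl) (auto simp: ext_basis_def wedge_single free.scale_right_distrib)
    also have "\<dots> = free_scale ((-1) ^ s) (ext_basis {j} \<and>\<^sub>e cap s \<phi> ?e + cap (Suc s) (shift_form j \<phi>) ?e)"
      by (simp only: cap_single wedge_sum_right sum.distrib mult_1 add.commute)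
    finally show ?thesis .
  qed
qed

section \<open>Division by monomials\<close>

lemma normal_form_0: "normal_form 0 = 0"
  by (rule normal_form_eqI) (simp_all add: reduced_def zero_nc_alg_def)

lemma normal_form_uminus: "normal_form (- a) = - normal_form a"
proof (rule normal_form_eqI)
  show "reduced (- normal_form a)"
    using normal_form(1)[of a] by (simp add: reduced_def)
  have "poly_class (- normal_form a) = - poly_class (normal_form a)"
    by (simp add: uminus_nc_alg.abs_eq)
  then show "poly_class (- normal_form a) = - a"
    by (simp add: normal_form(2))
qed

lemma monomial_quot_0: "monomial_quot 0 L = 0"
  by (simp add: monomial_quot_def normal_form_0 flip: zero_nc_alg_def)

lemma monomial_quot_uminus: "monomial_quot (- a) L = - monomial_quot a L"
  by (simp add: monomial_quot_def normal_form_uminus single_uminus sum_negf uminus_nc_alg.abs_eq)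

lemma monomial_quot_sign: "monomial_quot ((-1) ^ m * a) L = (-1) ^ m * monomial_quot a L"
  by (induction m) (simp_all add: monomial_quot_uminus)

lemma monomial_quot_empty: "monomial_quot a {} = a"
  by (simp add: monomial_quot_def sqfree_exp_def sum_single normal_form(2))

lemma monomial_dvd_0: "monomial_dvd L 0"
  by (simp add: monomial_dvd_def normal_form_0)

text \<open>Every monomial of \<open>a\<close> has exponent at least 1 at j, so subtracting and
  adding 1 there cancel; at all other variables both sides perform the same truncated
  subtraction.\<close>

lemma xvar_mult_monomial_quot:
  fixes a :: "('n::finite, 'k::field) nc_alg"
  assumes "monomial_dvd K a" "j \<in> K" "j \<notin> L"
  shows "xvar j * monomial_quot a (insert j L) = monomial_quot a L"
proof -
  have "Poly_Mapping.single j 1 + (\<alpha> - sqfree_exp (insert j L)) = \<alpha> - sqfree_exp L"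
    if "\<alpha> \<in> Poly_Mapping.keys (normal_form a)" for \<alpha>
  proof (rule poly_mapping_eqI)
    fix l
    have "Poly_Mapping.lookup \<alpha> j \<ge> 1"
      using assms that by (auto simp: monomial_dvd_def)
    then show "Poly_Mapping.lookup (Poly_Mapping.single j 1 + (\<alpha> - sqfree_exp (insert j L))) l =
        Poly_Mapping.lookup (\<alpha> - sqfree_exp L) l"
      using assms(3)
      by (auto simp: lookup_add lookup_minus lookup_single lookup_sqfree_exp when_def)
  qed
  then show ?thesis
    by (simp add: monomial_quot_def xvar_def pvar_def sum_distrib_left mult_single
        flip: poly_class_mult)
qed

text \<open>The functional e_S \<mapsto> f(e_S \<and> e_L)/x_L \<otimes> 1, where \<open>c K\<close>
  stands for f(e_K t^(p)) with p fixed; the sign of e_S \<and> e_L is pulled out of the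
  quotient.\<close>

definition quot_form ::
  "('n::{finite, linorder} set \<Rightarrow> ('n, 'k::field) nc_alg) \<Rightarrow> 'n set \<Rightarrow> 'n set \<Rightarrow> ('n, 'k) nc_env" where
  "quot_form c L S =
     (if S \<inter> L = {} then sgn_inv S L * (monomial_quot (c (S \<union> L)) L \<otimes> 1) else 0)"

text \<open>Evaluating at w \<and> e_j puts e_j in front of e_L. This is 0 for j in L; otherwise it
  belongs to L \<union> {j}, with a quotient by x_L that is x_j times the one by x_{L \<union> {j}}.
  Divisibility is used exactly here.\<close>

lemma shift_quot_form:
  assumes "\<And>K. monomial_dvd K (c K)"
  shows "shift_form j (quot_form c L) =
    (if j \<in> L then (\<lambda>_. 0) else (\<lambda>S. sgn_inv {j} L * (xvar j \<otimes> 1) * quot_form c (insert j L) S))"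
proof (cases "j \<in> L")
  case True
  then show ?thesis by (auto simp: shift_form_def quot_form_def fun_eq_iff)
next
  case False
  have "sgn_inv S {j} * (sgn_inv (insert j S) L * (monomial_quot (c (insert j S \<union> L)) L \<otimes> 1)) =
    sgn_inv {j} L * (xvar j \<otimes> 1) * (sgn_inv S (insert j L) * (monomial_quot (c (S \<union> insert j L)) (insert j L) \<otimes> 1))"
    if "j \<notin> S" for S
  proof -
    have "monomial_quot (c (insert j S \<union> L)) L \<otimes> 1 =
        (xvar j \<otimes> 1) * (monomial_quot (c (insert j S \<union> L)) (insert j L) \<otimes> 1)"
      using False by (simp add: tensor_mult xvar_mult_monomial_quot[OF assms])
    then show ?thesis
      by (simp add: inversions_insert_left[OF that] inversions_insert_right[OF False] power_add mult_ac)
  qed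
  then show ?thesis
    using False by (auto simp: shift_form_def quot_form_def fun_eq_iff)
qed

lemma cap_zero: "cap s (\<lambda>_. 0) w = 0"
  by (rule lin_eqI[where v = w]) (simp_all add: lin_cap lin_zero cap_single)

lemma cap_mult: "cap s (\<lambda>S. a * \<phi> S) w = free_scale a (cap s \<phi> w)"
  by (rule lin_eqI[where v = w])
    (simp_all add: lin_cap lin_scale cap_single free.scale_sum_right mult.left_commute)

text \<open>The extra terms take the shape and sign in which \<open>contraction_U_desc_wedge\<close>
  produces them for the set \<open>insert j L\<close>.\<close>

lemma cap_split_form_wedge:
  assumes "\<And>K. monomial_dvd K (c K)"
  shows "cap (card L) (quot_form c L) (split_form \<and>\<^sub>e w) =
    free_scale ((-1) ^ card L) (split_form \<and>\<^sub>e cap (card L) (quot_form c L) w)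
    + (\<Sum>j\<in>-L. free_scale (sgn_inv L {j} * (split_at j * (xvar j \<otimes> 1)))
        (cap (card (insert j L)) (quot_form c (insert j L)) w))"
proof -
  let ?C = "\<lambda>L. cap (card L) (quot_form c L) w"
  have shift: "free_scale (split_at j * (-1) ^ card L) (cap (Suc (card L)) (shift_form j (quot_form c L)) w) =
      (if j \<in> L then 0 else free_scale (sgn_inv L {j} * (split_at j * (xvar j \<otimes> 1))) (?C (insert j L)))" for j
  proof (cases "j \<in> L")
    case True
    then show ?thesis by (simp add: shift_quot_form[OF assms] cap_zero)
  next
    case False
    \<comment> \<open>Moving e_j from the front of e_L to its end costs (-1)^|L|.\<close>
    then have "(-1) ^ card L * sgn_inv {j} L = (sgn_inv L {j} :: ('a, 'b) nc_env)"
      by (simp add: sgn_inv_swap[of L "{j}"])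
    then show ?thesis
      using False by (simp add: shift_quot_form[OF assms] cap_mult) (simp add: mult_ac)
  qed
  have "cap (card L) (quot_form c L) (split_form \<and>\<^sub>e w) = (\<Sum>j\<in>UNIV. free_scale (split_at j)
      (cap (card L) (quot_form c L) (ext_basis {j} \<and>\<^sub>e w)))"
    by (simp only: split_form_def wedge_sum_left wedge_scale_left module_hom.sum[OF lin_cap]
        module_hom.scale[OF lin_cap])
  also have "\<dots> = (\<Sum>j\<in>UNIV. free_scale ((-1) ^ card L) (free_scale (split_at j) (ext_basis {j} \<and>\<^sub>e ?C L))
      + free_scale (split_at j * (-1) ^ card L) (cap (Suc (card L)) (shift_form j (quot_form c L)) w))"
    by (simp add: cap_ext_basis_wedge free.scale_right_distrib mult_ac)
  also have "\<dots> = free_scale ((-1) ^ card L) (split_form \<and>\<^sub>e ?C L)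
      + (\<Sum>j\<in>UNIV. free_scale (split_at j * (-1) ^ card L) (cap (Suc (card L)) (shift_form j (quot_form c L)) w))"
    by (simp only: sum.distrib split_form_def wedge_sum_left wedge_scale_left free.scale_sum_right)
  also have "(\<Sum>j\<in>UNIV. free_scale (split_at j * (-1) ^ card L) (cap (Suc (card L)) (shift_form j (quot_form c L)) w)) =
      (\<Sum>j\<in>-L. free_scale (sgn_inv L {j} * (split_at j * (xvar j \<otimes> 1))) (?C (insert j L)))"
    unfolding shift by (rule sum.mono_neutral_cong_right) auto
  finally show ?thesis .
qed

section \<open>The chain map\<close>

text \<open>All the maps of the family at once, applied to w t^(q). The condition r + s + 2u = j is
  absent; it is restored by a table \<open>c\<close> that vanishes outside degree i.\<close>

definition lift_total ::
  "('n::{finite, linorder} set \<Rightarrow> nat \<Rightarrow> ('n, 'k::field) nc_alg) \<Rightarrow> ('n, 'k) ext \<Rightarrow> nat \<Rightarrow> ('n, 'k) res" where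
  "lift_total c w q = (\<Sum>(u, L) | u + card L \<le> q.
     (U_desc L \<and>\<^sub>e cap (card L) (quot_form (\<lambda>K. c K (q - u - card L)) L) w) \<cdot>t u)"

lemma finite_lift_total_index: "finite {(u, L :: 'n::finite set). u + card L \<le> q}"
  by (rule finite_subset[of _ "{..q} \<times> UNIV"]) auto

lemma lin_lift_total: "lin (\<lambda>w. lift_total c w q)"
proof -
  have "lin (\<lambda>w. \<Sum>b\<in>{(u, L). u + card L \<le> q}.
     (U_desc (snd b) \<and>\<^sub>e cap (card (snd b)) (quot_form (\<lambda>K. c K (q - fst b - card (snd b))) (snd b)) w) \<cdot>t (fst b))"
    by (intro lin_sum lin_compose[OF lin_times_t] lin_compose[OF lin_wedge_right] lin_cap)
  then show ?thesis
    by (simp add: lift_total_def case_prod_beta)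
qed

lemma sum_pairs_Sigma:
  fixes M :: "('a \<times> 'b) set" and B :: "'a \<Rightarrow> 'b \<Rightarrow> 'c::finite set"
  assumes "finite M"
  shows "(\<Sum>(u, L)\<in>M. \<Sum>j\<in>B u L. g u L j) = (\<Sum>((u, L), j)\<in>(SIGMA (u, L):M. B u L). g u L j)"
  using sum.Sigma[OF assms, of "\<lambda>(u, L). B u L" "\<lambda>(u, L). g u L"] by (simp add: case_prod_unfold)

text \<open>On the left, contraction deletes some l from U_L but keeps the quotient by x_L; on the
  right, multiplication by W adds some j to the quotient but keeps U_L. Matching L with L \<union>
  {j} identifies these extra terms.\<close>

lemma dF_lift_total:
  fixes c :: "'n::{finite, linorder} set \<Rightarrow> nat \<Rightarrow> ('n, 'k::field) nc_alg"
  assumes dvd: "\<And>K p. monomial_dvd K (c K p)"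
  shows "dF (lift_total c w q) = lift_total c (contraction w) q
    + (if q = 0 then 0 else lift_total c (split_form \<and>\<^sub>e w) (q - 1))"
proof -
  let ?M = "\<lambda>q. {(u, L :: 'n set). u + card L \<le> q}"
  let ?C = "\<lambda>u L q. cap (card L) (quot_form (\<lambda>K. c K (q - u - card L)) L)"
  let ?a = "\<lambda>u L l. free_scale (sgn_inv L {l} * (split_at l * (xvar l \<otimes> 1))) (U_desc (L - {l}) \<and>\<^sub>e ?C u L q w) \<cdot>t u"
  let ?b = "\<lambda>u L. (U_desc L \<and>\<^sub>e ?C u L q (contraction w)) \<cdot>t u"
  let ?e = "\<lambda>u L q. free_scale ((-1) ^ card L) (U_desc L \<and>\<^sub>e split_form \<and>\<^sub>e ?C u L q w)"
  \<comment> \<open>In the term with the contraction of w, the sign (-1)^|L| from passing U_L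
    cancels the one from \<open>contraction_cap\<close>.\<close>
  have "dF ((U_desc L \<and>\<^sub>e ?C u L q w) \<cdot>t u) = (\<Sum>l\<in>L. ?a u L l) + ?b u L
      + (if u = 0 then 0 else ?e u L q \<cdot>t (u - 1))" for u L
    by (simp add: dF_times_t contraction_U_desc_wedge contraction_cap wedge_scale_right
        module_hom.add[OF lin_times_t] module_hom.sum[OF lin_times_t]
        split_form_wedge_U_desc flip: power_mult_distrib)
  then have "dF (lift_total c w q) = (\<Sum>(u, L)\<in>?M q. \<Sum>l\<in>L. ?a u L l) + lift_total c (contraction w) q
      + (\<Sum>(u, L)\<in>?M q. if u = 0 then 0 else ?e u L q \<cdot>t (u - 1))"
    by (simp add: lift_total_def module_hom.sum[OF lin_dF] case_prod_beta sum.distrib)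
  moreover have "lift_total c (split_form \<and>\<^sub>e w) (q - 1) =
      (\<Sum>(u, L)\<in>?M q. \<Sum>l\<in>L. ?a u L l) + (\<Sum>(u, L)\<in>?M q. if u = 0 then 0 else ?e u L q \<cdot>t (u - 1))"
    if "q > 0"
  proof -
    let ?a' = "\<lambda>u L j. free_scale (sgn_inv L {j} * (split_at j * (xvar j \<otimes> 1)))
        (U_desc L \<and>\<^sub>e ?C u (insert j L) q w) \<cdot>t u"
    have "(U_desc L \<and>\<^sub>e ?C u L (q - 1) (split_form \<and>\<^sub>e w)) \<cdot>t u =
        ?e u L (q - 1) \<cdot>t u + (\<Sum>j\<in>-L. ?a' u L j)" for u L
    proof -
      have "(U_desc L \<and>\<^sub>e ?C u L (q - 1) (split_form \<and>\<^sub>e w)) \<cdot>t u = ?e u L (q - 1) \<cdot>t u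
          + (\<Sum>j\<in>-L. free_scale (sgn_inv L {j} * (split_at j * (xvar j \<otimes> 1))) (U_desc L \<and>\<^sub>e
              cap (card (insert j L)) (quot_form (\<lambda>K. c K (q - 1 - u - card L)) (insert j L)) w) \<cdot>t u)"
        by (simp only: cap_split_form_wedge[OF dvd] wedge_add_right wedge_sum_right wedge_scale_right
            module_hom.add[OF lin_times_t] module_hom.sum[OF lin_times_t])
      \<comment> \<open>The index q - 1 - u - |L| of t equals q - u - |L \<union> {j}|.\<close>
      also have "(\<Sum>j\<in>-L. free_scale (sgn_inv L {j} * (split_at j * (xvar j \<otimes> 1))) (U_desc L \<and>\<^sub>e
              cap (card (insert j L)) (quot_form (\<lambda>K. c K (q - 1 - u - card L)) (insert j L)) w) \<cdot>t u) =
          (\<Sum>j\<in>-L. ?a' u L j)"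
        by (rule sum.cong) simp_all
      finally show ?thesis .
    qed
    then have "lift_total c (split_form \<and>\<^sub>e w) (q - 1) =
        (\<Sum>(u, L)\<in>?M (q - 1). \<Sum>j\<in>-L. ?a' u L j) + (\<Sum>(u, L)\<in>?M (q - 1). ?e u L (q - 1) \<cdot>t u)"
      by (simp add: lift_total_def case_prod_beta sum.distrib)
    also have "(\<Sum>(u, L)\<in>?M (q - 1). \<Sum>j\<in>-L. ?a' u L j) = (\<Sum>((u, L), j)\<in>(SIGMA (u, L):?M (q - 1). -L). ?a' u L j)"
      by (rule sum_pairs_Sigma[OF finite_lift_total_index])
    also have "\<dots> = (\<Sum>((u, L), l)\<in>(SIGMA (u, L):?M q. L). ?a u L l)"
    proof -
      have inv: "inversions (insert j L) {j} = inversions L {j}" if "j \<notin> L" for j and L :: "'n set"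
        using that by (simp add: inversions_insert_left[of j L])
      have le: "u + (card L - Suc 0) \<le> q - Suc 0" if "u + card L \<le> q" "l \<in> L" for u l and L :: "'n set"
      proof -
        have "card L > 0" using that by (auto simp: card_gt_0_iff)
        then show ?thesis using that by simp
      qed
      show ?thesis
      proof (rule sum.reindex_bij_witness[where i = "\<lambda>((u, L), l). ((u, L - {l}), l)"
              and j = "\<lambda>((u, L), j). ((u, insert j L), j)"], goal_cases)
        case (1 b)
        then show ?case by auto
      next
        case (2 b)
        then show ?case using \<open>q > 0\<close> by auto
      next
        case (3 b)
        then show ?case by auto
      next
        case (4 b)
        then show ?case by (auto simp: le)
      next
        case (5 b)
        then show ?case by (auto simp: inv simp del: card_insert_disjoint)
      qed
    qed
    also have "\<dots> = (\<Sum>(u, L)\<in>?M q. \<Sum>l\<in>L. ?a u L l)"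
      by (rule sum_pairs_Sigma[OF finite_lift_total_index, symmetric])
    \<comment> \<open>W consumes one t: the summand at (u, L) is the one at (u + 1, L) on the right,
      where the summands with u = 0 are 0.\<close>
    also have "(\<Sum>(u, L)\<in>?M (q - 1). ?e u L (q - 1) \<cdot>t u) =
        (\<Sum>(u, L)\<in>?M q. if u = 0 then 0 else ?e u L q \<cdot>t (u - 1))"
      by (rule sum.reindex_bij_witness_not_neutral[where S' = "{}" and T' = "{(u, L)\<in>?M q. u = 0}"
            and i = "\<lambda>(u, L). (u - 1, L)" and j = "\<lambda>(u, L). (Suc u, L)"])
        (use that in \<open>auto intro: finite_subset[OF _ finite_lift_total_index[of q]]\<close>)
    finally show ?thesis .
  qed
  \<comment> \<open>For q = 0 the only index is (0, {}), which has no l to contract and no t to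
    lower.\<close>
  moreover have "(\<Sum>(u, L)\<in>?M q. \<Sum>l\<in>L. ?a u L l)
      + (\<Sum>(u, L)\<in>?M q. if u = 0 then 0 else ?e u L q \<cdot>t (u - 1)) = 0" if "q = 0"
  proof -
    have "?M 0 = {(0, {})}" by auto
    then show ?thesis unfolding that by simp
  qed
  ultimately show ?thesis by (cases "q = 0") (simp_all add: ac_simps)
qed

section \<open>Comparison with the defining formula\<close>

lemma mult_map_0: "mult_map 0 = 0"
  using mult_map_diff[of 0 0] by simp

lemma mult_map_uminus: "mult_map (- z) = - mult_map z"
  using mult_map_diff[of 0 z] by (simp add: mult_map_0)

lemma mult_map_add: "mult_map (y + z) = mult_map y + mult_map z"
  by transfer (rule mult_pairs_add)

lemma mult_map_sum: "mult_map (sum g B) = (\<Sum>b\<in>B. mult_map (g b))"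
  by (induction B rule: infinite_finite_induct) (simp_all add: mult_map_0 mult_map_add)

lemma mult_map_sign: "mult_map ((-1) ^ m) = (-1) ^ m"
  by (induction m) (simp_all add: mult_map_1 mult_map_mult mult_map_uminus)

text \<open>Off \<open>F i\<close> the function \<open>f\<close> is arbitrary. The value 0 there
  makes divisibility hold for all K and p and discards the summands of wrong degree.\<close>

definition basis_value ::
  "(('n::{finite, linorder}, 'k::field) res \<Rightarrow> ('n, 'k) nc_alg) \<Rightarrow> nat \<Rightarrow> 'n set \<Rightarrow> nat \<Rightarrow> ('n, 'k) nc_alg" where
  "basis_value f i K p = (if card K + 2 * p = i then f (Poly_Mapping.single (K, p) 1) else 0)"

lemma quot_form_basis_value_eq_0:
  assumes "card S + card L + 2 * p \<noteq> i"
  shows "quot_form (\<lambda>K. basis_value f i K p) L S = 0"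
  using assms
  by (simp add: quot_form_def basis_value_def card_Un_disjoint monomial_quot_0 tensor_0_left)

lemma module_hom_between_zero:
  fixes f :: "('n::finite, 'k::field) res \<Rightarrow> 'c::ab_group_add"
  assumes "module_hom_between s s' (F i) N f"
  shows "f 0 = 0"
proof -
  have "f 0 + f 0 = f (0 + 0)"
    using assms zero_in_F[of i] unfolding module_hom_between_def by metis
  then show ?thesis by simp
qed

lemma monomial_quot_eval:
  fixes f :: "('n::{finite, linorder}, 'k::field) res \<Rightarrow> ('n, 'k) nc_alg"
  assumes hom: "module_hom_between free_scale alg_scale (F i) UNIV f"
    and deg: "card S + card L + 2 * p = i"
  shows "monomial_quot (f ((ext_basis S \<and>\<^sub>e ext_basis L) \<cdot>t p)) L \<otimes> 1 =
    quot_form (\<lambda>K. basis_value f i K p) L S"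
proof (cases "S \<inter> L = {}")
  case True
  then have "card (S \<union> L) + 2 * p = i"
    using deg by (simp add: card_Un_disjoint)
  then have "f (free_scale (sgn_inv S L) (Poly_Mapping.single (S \<union> L, p) 1)) =
      mult_map (sgn_inv S L) * basis_value f i (S \<union> L) p"
    using hom single_in_F[of "S \<union> L" p i 1]
    unfolding module_hom_between_def alg_scale_def basis_value_def
    by (auto simp del: free_scale_single)
  then show ?thesis
    using True
    by (simp add: wedge_basis quot_form_def mult_map_sign monomial_quot_sign tensor_sign_left)
next
  case False
  then show ?thesis
    using module_hom_between_zero[OF hom] by (simp add: wedge_basis quot_form_def monomial_quot_0 tensor_0_left)
qed

lemma card_nth_elem_image:
  fixes I :: "'n::{finite, linorder} set"
  assumes "P \<subseteq> {1..card I}"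
  shows "card (nth_elem I ` P) = card P"
  by (rule card_image, rule inj_on_subset[OF bij_betw_imp_inj_on[OF bij_betw_nth_elem]])
    (use assms in auto)

lemma nth_elem_image_subset:
  fixes I :: "'n::{finite, linorder} set"
  assumes "P \<subseteq> {1..card I}"
  shows "nth_elem I ` P \<subseteq> I"
  using bij_betw_imp_surj_on[OF bij_betw_nth_elem[of I]] assms by auto

lemma card_Diff_nth_elem_image:
  fixes I :: "'n::{finite, linorder} set"
  assumes "P \<subseteq> {1..card I}"
  shows "card (I - nth_elem I ` P) + card P = card I"
  using nth_elem_image_subset[OF assms] card_mono[OF _ nth_elem_image_subset[OF assms]]
  by (simp add: card_Diff_subset card_nth_elem_image[OF assms])

lemma lift_summand_eq:
  fixes f :: "('n::{finite, linorder}, 'k::field) res \<Rightarrow> ('n, 'k) nc_alg"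
  assumes hom: "module_hom_between free_scale alg_scale (F i) UNIV f"
    and P: "P \<subseteq> {1..card I}" and le: "u + card L \<le> q"
    and deg: "card I + 2 * q = i + (card P + card L + 2 * u)"
  shows "lift_summand f I q u P L = (U_desc L \<and>\<^sub>e Poly_Mapping.single (nth_elem I ` P)
    ((-1) ^ (card I * card L) * sgn_inv (nth_elem I ` P) (I - nth_elem I ` P)
      * quot_form (\<lambda>K. basis_value f i K (q - u - card L)) L (I - nth_elem I ` P))) \<cdot>t u"
proof -
  let ?J = "nth_elem I ` P"
  have "card (I - ?J) + card L + 2 * (q - u - card L) = i"
    using card_Diff_nth_elem_image[OF P] le deg by linarith
  then have "monomial_quot (eval_t f (ext_basis (I - ?J) \<and>\<^sub>e ext_basis L) q (u + card L)) L \<otimes> 1 =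
      quot_form (\<lambda>K. basis_value f i K (q - u - card L)) L (I - ?J)" (is "_ = ?\<phi>")
    using le by (simp add: eval_t_def monomial_quot_eval[OF hom] diff_diff_left)
  \<comment> \<open>The truncated subtraction splits because |P| is at most the sum of P.\<close>
  moreover have "card I * card L + \<Sum>P - card P = card I * card L + (\<Sum>P - card P)"
    using card_le_sum_positive[OF P] by simp
  ultimately have "lift_summand f I q u P L = free_scale ((-1) ^ (card I * card L) * ?\<phi>)
      ((U_desc L \<and>\<^sub>e free_scale ((-1) ^ (\<Sum>P - card P))
        (ext_seq (map (nth_elem I) (rev (sorted_list_of_set P))))) \<cdot>t u)"
    by (simp add: lift_summand_def U_desc_def wedge_scale_right module_hom.scale[OF lin_times_t]
        power_add mult_ac)
  also have "\<dots> = (U_desc L \<and>\<^sub>e free_scale ((-1) ^ (card I * card L) * ?\<phi>)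
      (Poly_Mapping.single ?J (sgn_inv ?J (I - ?J)))) \<cdot>t u"
    by (simp only: sign_mult_ext_seq[OF P] wedge_scale_right module_hom.scale[OF lin_times_t])
  finally show ?thesis by (simp add: mult_ac)
qed

lemma finite_lift_index: "finite (lift_index m j :: (nat \<times> nat set \<times> 'n::finite set) set)"
  by (rule finite_subset[of _ "{..j} \<times> Pow {1..m} \<times> UNIV"]) (auto simp: lift_index_def)

lemma lift_basis_eq_lift_total:
  fixes f :: "('n::{finite, linorder}, 'k::field) res \<Rightarrow> ('n, 'k) nc_alg"
  assumes hom: "module_hom_between free_scale alg_scale (F i) UNIV f"
    and deg: "card I + 2 * q = i + j"
  shows "lift_basis f j (I, q) = lift_total (basis_value f i) (Poly_Mapping.single I 1) q"
proof -
  let ?M = "{(u, L :: 'n set). u + card L \<le> q}"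
  let ?T = "\<lambda>u L J. (U_desc L \<and>\<^sub>e Poly_Mapping.single J ((-1) ^ (card I * card L) * sgn_inv J (I - J)
      * quot_form (\<lambda>K. basis_value f i K (q - u - card L)) L (I - J))) \<cdot>t u"
  let ?m = "card I"
  have "lift_total (basis_value f i) (Poly_Mapping.single I 1) q = (\<Sum>(u, L)\<in>?M. \<Sum>J\<in>Pow I. ?T u L J)"
    by (simp add: lift_total_def cap_single wedge_sum_right module_hom.sum[OF lin_times_t])
  also have "\<dots> = (\<Sum>(u, L)\<in>?M. \<Sum>P\<in>Pow {1..?m}. ?T u L (nth_elem I ` P))"
    by (simp only: sum.reindex_bij_betw[OF bij_betw_Pow[OF bij_betw_nth_elem[OF finite]], symmetric])
  also have "\<dots> = (\<Sum>((u, L), P)\<in>?M \<times> Pow {1..?m}. ?T u L (nth_elem I ` P))"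
    using sum.Sigma[OF finite_lift_total_index[of q], of "\<lambda>_. Pow {1..?m}"
        "\<lambda>(u, L) P. ?T u L (nth_elem I ` P)"]
    by (simp add: case_prod_unfold)
  \<comment> \<open>Given the degree of e_I t^(q), the equation r + s + 2u = j says exactly that f
    is evaluated in degree i; otherwise \<open>basis_value\<close> is 0.\<close>
  also have "\<dots> = (\<Sum>((u, L), P)\<in>{((u, L), P)\<in>?M \<times> Pow {1..?m}. card P + card L + 2 * u = j}.
      ?T u L (nth_elem I ` P))"
  proof -
    have "?T u L (nth_elem I ` P) = 0"
      if "u + card L \<le> q" "P \<subseteq> {1..?m}" "card P + card L + 2 * u \<noteq> j" for u L P
    proof -
      have "card (I - nth_elem I ` P) + card L + 2 * (q - u - card L) \<noteq> i"
        using card_Diff_nth_elem_image[OF that(2)] that(1,3) deg by linarith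
      then show ?thesis
        by (simp add: quot_form_basis_value_eq_0 module_hom.zero[OF lin_times_t])
    qed
    then show ?thesis
      by (intro sum.mono_neutral_right) (auto simp: finite_lift_total_index)
  qed
  \<comment> \<open>\<open>lift_index\<close> does not bound u + |L| by q; the additional triples
    contribute 0 by the convention for negative indices of t.\<close>
  also have "\<dots> = (\<Sum>(u, P, L)\<in>lift_index ?m j. lift_summand f I q u P L)"
  proof (rule sum.reindex_bij_witness_not_neutral[
        where S' = "{}" and T' = "{(u, P, L)\<in>lift_index ?m j. q < u + card L}"
          and i = "\<lambda>(u, P, L). ((u, L), P)" and j = "\<lambda>((u, L), P). (u, P, L)"], goal_cases)
    case 2
    show ?case by (rule finite_subset[OF _ finite_lift_index]) auto
  next
    case (8 b)
    then show ?case
      by (auto simp: lift_summand_def eval_t_def monomial_quot_0 tensor_0_left)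
  next
    case (9 b)
    then obtain u L P where b: "b = ((u, L), P)" "u + card L \<le> q" "P \<subseteq> {1..?m}"
      "card P + card L + 2 * u = j" by auto
    then show ?case
      using lift_summand_eq[OF hom b(3,2)] deg by simp
  qed (auto simp: lift_index_def)
  finally show ?thesis by (simp add: lift_basis_def)
qed

section \<open>Degrees\<close>

definition ext_degree :: "nat \<Rightarrow> ('n::finite, 'k::field) ext set" where
  "ext_degree d = {w. \<forall>I\<in>Poly_Mapping.keys w. card I = d}"

lemma F_scale: "v \<in> F m \<Longrightarrow> free_scale c v \<in> F m"
  by (auto simp: F_def in_keys_iff lookup_free_scale)

lemma times_t_in_F:
  assumes "w \<in> ext_degree d" "d + 2 * u = m"
  shows "w \<cdot>t u \<in> F m"
  unfolding times_t_def
  by (intro sum_in_F single_in_F) (use assms in \<open>auto simp: ext_degree_def\<close>)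

lemma single_in_ext_degree: "card I = d \<Longrightarrow> Poly_Mapping.single I c \<in> ext_degree d"
  by (cases "c = 0") (simp_all add: ext_degree_def)

lemma add_in_ext_degree: "v \<in> ext_degree d \<Longrightarrow> w \<in> ext_degree d \<Longrightarrow> v + w \<in> ext_degree d"
  using keys_add[of v w] by (fastforce simp: ext_degree_def)

lemma sum_in_ext_degree: "(\<And>b. b \<in> B \<Longrightarrow> g b \<in> ext_degree d) \<Longrightarrow> sum g B \<in> ext_degree d"
  by (induction B rule: infinite_finite_induct) (auto simp: add_in_ext_degree, simp_all add: ext_degree_def)

lemma scale_in_ext_degree: "w \<in> ext_degree d \<Longrightarrow> free_scale c w \<in> ext_degree d"
  by (auto simp: ext_degree_def in_keys_iff lookup_free_scale)

lemma wedge_in_ext_degree: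
  assumes "v \<in> ext_degree d" "w \<in> ext_degree d'"
  shows "v \<and>\<^sub>e w \<in> ext_degree (d + d')"
proof -
  have "0 \<in> ext_degree (d + d')"
    by (simp add: ext_degree_def)
  then show ?thesis
    unfolding wedge_def using assms
    by (auto simp: ext_degree_def[of d] ext_degree_def[of d'] card_Un_disjoint
        intro!: sum_in_ext_degree single_in_ext_degree)
qed

lemma ext_basis_in_ext_degree: "card I = d \<Longrightarrow> ext_basis I \<in> ext_degree d"
  unfolding ext_basis_def by (rule single_in_ext_degree)

lemma wedge_list_in_ext_degree:
  "(\<And>v. v \<in> set vs \<Longrightarrow> v \<in> ext_degree 1) \<Longrightarrow> wedge_list vs \<in> ext_degree (length vs)"
proof (induction vs)
  case Nil
  show ?case by (simp add: wedge_list_def ext_basis_in_ext_degree)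
next
  case (Cons v vs)
  then show ?case
    using wedge_in_ext_degree[of v 1 "wedge_list vs" "length vs"] by (simp add: wedge_list_def)
qed

lemma U_in_ext_degree: "U l \<in> ext_degree 1"
  unfolding U_def by (intro sum_in_ext_degree scale_in_ext_degree ext_basis_in_ext_degree) simp

lemma split_form_in_ext_degree: "split_form \<in> ext_degree 1"
  unfolding split_form_def
  by (intro sum_in_ext_degree scale_in_ext_degree ext_basis_in_ext_degree) simp

lemma lift_summand_in_F:
  fixes L :: "'n::{finite, linorder} set"
  assumes "(u, P, L) \<in> lift_index m j"
  shows "lift_summand f I q u P L \<in> F j"
proof -
  have "finite P" "card P + card L + 2 * u = j"
    using assms by (auto simp: lift_index_def intro: finite_subset)
  \<comment> \<open>The degree comes out as the length of a list; the substitution rewrites it as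
    |L|.\<close>
  moreover have "wedge_list (map U (rev (sorted_list_of_set L))) \<in> ext_degree (card L)"
    by (rule wedge_list_in_ext_degree[THEN subst[where P = "\<lambda>d. _ \<in> ext_degree d", rotated]])
      (auto simp: U_in_ext_degree simp del: One_nat_def)
  moreover have "ext_seq (map (nth_elem I) (rev (sorted_list_of_set P))) \<in> ext_degree (card P)"
    unfolding ext_seq_def
    by (rule wedge_list_in_ext_degree[THEN subst[where P = "\<lambda>d. _ \<in> ext_degree d", rotated]])
      (auto simp: ext_basis_in_ext_degree simp del: One_nat_def)
  ultimately show ?thesis
    unfolding lift_summand_def
    by (intro F_scale times_t_in_F[OF wedge_in_ext_degree[of _ "card L" _ "card P"]]) auto
qed

lemma f_tilde_in_F: "f_tilde f j v \<in> F j"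
proof -
  have "lift_basis f j b \<in> F j" for b
    unfolding lift_basis_def by (cases b) (auto intro!: sum_in_F lift_summand_in_F)
  then show ?thesis
    unfolding f_tilde_def linear_extension_def by (intro sum_in_F F_scale)
qed

lemma dF_in_F:
  fixes v :: "('n::{finite, linorder}, 'k::field) res"
  assumes "v \<in> F (Suc m)"
  shows "dF v \<in> F m"
proof -
  have "dF (Poly_Mapping.single (I, q) 1) \<in> (F m :: ('n, 'k) res set)"
    if "card I + 2 * q = Suc m" for I q
  proof -
    have "card (I - {i}) + 2 * q = m" if "i \<in> I" for i
      using card_Suc_Diff1[OF finite that] \<open>card I + 2 * q = Suc m\<close> by linarith
    then have "contraction (Poly_Mapping.single I 1) \<cdot>t q \<in> (F m :: ('n, 'k) res set)"
      unfolding contraction_single module_hom.sum[OF lin_times_t] times_t_single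
      by (intro sum_in_F single_in_F)
    moreover have "(split_form \<and>\<^sub>e Poly_Mapping.single I 1) \<cdot>t (q - 1) \<in> (F m :: ('n, 'k) res set)" if "q \<noteq> 0"
      by (rule times_t_in_F[OF wedge_in_ext_degree[OF split_form_in_ext_degree single_in_ext_degree[OF refl]]])
        (use that \<open>card I + 2 * q = Suc m\<close> in simp)
    ultimately show ?thesis
      by (auto simp: dF_times_t add_in_F zero_in_F simp flip: times_t_single)
  qed
  then have "free_scale (Poly_Mapping.lookup v b) (diff_basis b) \<in> F m" if "b \<in> Poly_Mapping.keys v" for b
    using assms that by (cases b) (auto simp: F_def[of "Suc m"] dF_def linear_extension_single intro!: F_scale)
  then show ?thesis
    unfolding dF_def linear_extension_def by (intro sum_in_F)
qed

section \<open>Assembly on the whole complex\<close>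

text \<open>One map on the direct sum of all F_m, agreeing with \<open>f_tilde f j\<close> on
  \<open>F (i + j)\<close>.\<close>

definition total_map ::
  "(('n::{finite, linorder}, 'k::field) res \<Rightarrow> ('n, 'k) nc_alg) \<Rightarrow> nat \<Rightarrow> ('n, 'k) res \<Rightarrow> ('n, 'k) res" where
  "total_map f i = linear_extension (\<lambda>(I, q). lift_total (basis_value f i) (Poly_Mapping.single I 1) q)"

lemma total_map_times_t: "total_map f i (w \<cdot>t q) = lift_total (basis_value f i) w q"
proof (rule lin_eqI[where v = w])
  show "lin (\<lambda>w. total_map f i (w \<cdot>t q))"
    unfolding total_map_def by (intro lin_compose[OF lin_linear_extension] lin_times_t)
qed (simp_all add: lin_lift_total total_map_def times_t_single linear_extension_single)

lemma f_tilde_eq_total_map: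
  assumes "module_hom_between free_scale alg_scale (F i) UNIV f" "v \<in> F (i + j)"
  shows "f_tilde f j v = total_map f i v"
  unfolding f_tilde_def total_map_def linear_extension_def
  using assms(2)
  by (intro sum.cong refl) (auto simp: F_def lift_basis_eq_lift_total[OF assms(1)])

lemma dF_total_map:
  fixes f :: "('n::{finite, linorder}, 'k::field) res \<Rightarrow> ('n, 'k) nc_alg"
  assumes hom: "module_hom_between free_scale alg_scale (F i) UNIV f"
    and cocycle: "\<forall>v\<in>F (i + 1). f (dF v) = 0"
  shows "dF (total_map f i v) = total_map f i (dF v)"
proof (rule lin_eqI[where v = v])
  have lin: "lin (total_map f i)"
    unfolding total_map_def by (rule lin_linear_extension)
  show "lin (\<lambda>v. dF (total_map f i v))" "lin (\<lambda>v. total_map f i (dF v))"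
    by (intro lin_compose[OF lin_dF] lin lin_compose[OF lin] lin_dF)+
  \<comment> \<open>The cocycle condition is used here and nowhere else in the commutation with
    d.\<close>
  have dvd: "monomial_dvd K (basis_value f i K p)" for K p
    using cocycle_monomial_dvd[OF hom cocycle] by (simp add: basis_value_def monomial_dvd_0)
  fix b :: "'n set \<times> nat"
  obtain I q where b: "b = (I, q)" by (cases b)
  show "dF (total_map f i (Poly_Mapping.single b 1)) = total_map f i (dF (Poly_Mapping.single b 1))"
    unfolding b times_t_single[symmetric]
    by (simp add: total_map_times_t dF_times_t dF_lift_total[OF dvd] module_hom.add[OF lin]
        module_hom.zero[OF lin])
qed

lemma f_tilde_0_augmentation:
  fixes f :: "('n::{finite, linorder}, 'k::field) res \<Rightarrow> ('n, 'k) nc_alg"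
  assumes hom: "module_hom_between free_scale alg_scale (F i) UNIV f" and v: "v \<in> F i"
  shows "\<epsilon> (f_tilde f 0 v) = f v"
proof -
  \<comment> \<open>For j = 0 the only triple is (0, {}, {}), so a basis element is sent to f of it,
    placed in the left tensor factor; multiplication recovers the value.\<close>
  have index: "lift_index m 0 = {(0, {}, {} :: 'n set)}" for m
    by (auto simp: lift_index_def card_eq_0_iff intro: finite_subset)
  have basis: "lift_basis f 0 (I, q) = Poly_Mapping.single ({}, 0) (f (Poly_Mapping.single (I, q) 1) \<otimes> 1)" for I q
    by (simp add: lift_basis_def index lift_summand_def wedge_list_def ext_seq_def eval_t_def
        monomial_quot_empty wedge_one_left ext_basis_times_t wedge_one_right)
  have f_sum: "f (sum g B) = (\<Sum>b\<in>B. f (g b))" if "\<And>b. b \<in> B \<Longrightarrow> g b \<in> F i"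
    for g :: "'n set \<times> nat \<Rightarrow> ('n, 'k) res" and B
    using that
  proof (induction B rule: infinite_finite_induct)
    case (insert b B)
    then show ?case using hom by (simp add: module_hom_between_def sum_in_F)
  qed (simp_all add: module_hom_between_zero[OF hom])
  have single: "Poly_Mapping.single b 1 \<in> (F i :: ('n, 'k) res set)" if "b \<in> Poly_Mapping.keys v" for b
    using that v by (cases b) (auto simp: F_def[of i])
  have "\<epsilon> (f_tilde f 0 v) = (\<Sum>b\<in>Poly_Mapping.keys v.
      mult_map (Poly_Mapping.lookup v b) * f (Poly_Mapping.single b 1))"
    by (simp add: augmentation_def f_tilde_def linear_extension_def lookup_sum lookup_free_scale
        mult_map_sum)
      (auto simp: basis mult_map_mult mult_map_tensor intro!: sum.cong)
  also have "\<dots> = (\<Sum>b\<in>Poly_Mapping.keys v.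
      f (free_scale (Poly_Mapping.lookup v b) (Poly_Mapping.single b 1)))"
    using hom single by (intro sum.cong refl)
      (simp add: module_hom_between_def alg_scale_def del: free_scale_single)
  also have "\<dots> = f (\<Sum>b\<in>Poly_Mapping.keys v. free_scale (Poly_Mapping.lookup v b) (Poly_Mapping.single b 1))"
    by (rule f_sum[symmetric]) (intro F_scale single)
  finally show ?thesis
    unfolding eq_sum_basis[of v, symmetric] .
qed

theorem proposition3p3:
  fixes f :: "('n::{finite, linorder}, 'k::field) res \<Rightarrow> ('n, 'k) nc_alg" and i :: nat
  assumes hom: "module_hom_between free_scale alg_scale (F i) UNIV f"
    and cocycle: "\<forall>v\<in>F (i + 1). f (dF v) = 0"
  shows "(\<forall>j. module_hom_between free_scale free_scale (F (i + j)) (F j) (f_tilde f j))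
    \<and> (\<forall>v\<in>F i. \<epsilon> (f_tilde f 0 v) = f v)
    \<and> (\<forall>j\<ge>1. \<forall>v\<in>F (i + j). dF (f_tilde f j v) = f_tilde f (j - 1) (dF v))"
proof (intro conjI allI ballI impI)
  fix j
  show "module_hom_between free_scale free_scale (F (i + j)) (F j) (f_tilde f j)"
    by (simp add: module_hom_between_def f_tilde_in_F module_hom.add[OF lin_f_tilde]
        module_hom.scale[OF lin_f_tilde])
next
  fix v :: "('n, 'k) res" assume "v \<in> F i"
  with hom show "\<epsilon> (f_tilde f 0 v) = f v" by (rule f_tilde_0_augmentation)
next
  fix j :: nat and v :: "('n, 'k) res" assume j: "j \<ge> 1" and v: "v \<in> F (i + j)"
  \<comment> \<open>Since \<open>dF v\<close> lies in \<open>F (i + (j - 1))\<close>, both maps in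
    the equation are restrictions of the same \<open>total_map f i\<close>.\<close>
  from j v have "dF v \<in> F (i + (j - 1))"
    by (intro dF_in_F) simp
  with v show "dF (f_tilde f j v) = f_tilde f (j - 1) (dF v)"
    by (simp only: f_tilde_eq_total_map[OF hom] dF_total_map[OF hom cocycle])
qed

end
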